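(* Let $\mathbb K\in\{\mathbb R,\mathbb C\}$, let $G$ be a compact group, $X$ a homogeneous space of $G$, $(\rho_j:G\to \mathrm U(V_j))_{j\in\widehat G}$ representatives of all isomorphism classes of irreducible unitary representations of $G$ over $\mathbb K$, and let $\rho_l:G\to \mathrm U(V_l)$ and $\rho_J:G\to\mathrm U(V_J)$, $l,J\in\widehat G$, be the (irreducible) input and output representations. Let $\{Y_{ji}^m \mid j\in\widehat G,\ i=1,\dots,m_j,\ m=1,\dots,d_j\}$ be the harmonic basis functions in $L^2_{\mathbb K}(X)$ and $\langle s,JM\,|\,jm;ln\rangle$ the Clebsch-Gordan coefficients. Then there is an isomorphism of $\mathbb K$-vector spaces $$\mathrm{GKer}:\ \bigoplus_{j\in\widehat G}\bigoplus_{i=1}^{m_j}\bigoplus_{s=1}^{[J(jl)]}\mathrm{End}_{G,\mathbb K}(V_J)\ \longrightarrow\ \mathrm{Hom}_G\big(X,\mathrm{Hom}_{\mathbb K}(V_l,V_J)\big)$$ onto the space of $G$-steerable kernels, such that the kernel $K=\mathrm{GKer}((c_{jis})_{jis})$, with $c_{jis}\in\mathrm{End}_{G,\mathbb K}(V_J)$, has for all $x\in X$, $M\le d_J$, $n\le d_l$ the matrix elements $$\langle JM|K(x)|ln\rangle=\sum_{j\in\widehat G}\sum_{i=1}^{m_j}\sum_{s=1}^{[J(jl)]}\sum_{m=1}^{d_j}\sum_{M'=1}^{d_J}\langle JM|c_{jis}|JM'\rangle\cdot\langle s,JM'\,|\,jm;ln\rangle\cdot\langle i,jm|x\rangle .$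$
   Context: Compact groups are compact Hausdorff topological groups. A homogeneous space $X$ of $G$ is a nonempty Hausdorff space with a continuous transitive left $G$-action; it carries the unique $G$-invariant normalized (Haar) measure, with respect to which $L^2_{\mathbb K}(X)$ is formed. Inner products are antilinear in the first and linear in the second argument. Representations are continuous (i.e. $g\mapsto\rho(g)v$ is continuous for each $v$); for $\mathbb K=\mathbb R$, "unitary" means orthogonal. $\widehat G$ is the set of isomorphism classes of irreducible unitary representations over $\mathbb K$ (all finite-dimensional), $d_j=\dim_{\mathbb K} V_j$, and $\{Y_j^m\}_{m=1}^{d_j}$ is a fixed orthonormal basis of $V_j$; $\rho_j^{m'm}(g)=\langle Y_j^{m'}|\rho_j(g)Y_j^m\rangle$. A $G$-steerable kernel is any function $K:X\to\mathrm{Hom}_{\mathbb K}(V_l,V_J)$ (linear maps) with $K(gx)=\rho_J(g)\circ K(x)\circ\rho_l(g)^{-1}$ for all $g\in G,x\in X$; the vector space of these is $\mathrm{Hom}_G(X,\mathrm{Hom}_{\mathbb K}(V_l,V_J))$. $\mathrm{End}_{G,\mathbb K}(V_J)$ is the space of linear maps $c:V_J\to V_J$ with $c\circ\rho_J(g)=\rho_J(g)\circ c$ for all $g$. Harmonic basis functions: by the Peter-Weyl theorem there are multiplicities $m_j\in\mathbb N_{\ge0}$, $m_j\le d_j$, and functions $Y_{ji}^m:X\to\mathbb K$ ($j\in\widehat G$, $1\le i\le m_j$, $1\le m\le d_j$) with $Y_{ji}^m(g^{-1}x)=\sum_{m'}\rho_j^{m'm}(g)Y_{ji}^{m'}(x)$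 for all $g,x$, which form an orthonormal (Hilbert) basis of $L^2_{\mathbb K}(X)$. These are fixed. Write $\langle i,jm|x\rangle:=\overline{Y_{ji}^m(x)}$. Clebsch-Gordan coefficients: $[J(jl)]$ is the multiplicity of $V_J$ in the decomposition of $V_j\otimes V_l$ (with representation $\rho_j\otimes\rho_l$) into irreducibles; fix an equivariant isomorphism $\mathrm{CG}_{jl}:V_j\otimes V_l\to\bigoplus_{J\in\widehat G}\bigoplus_{s=1}^{[J(jl)]}V_J$, let $Y_{Js}^M$ be the copy of $Y_J^M$ in the $s$-th summand $V_J$, and put $\langle s,JM|jm;ln\rangle:=\langle Y_{Js}^M|\mathrm{CG}_{jl}(Y_j^m\otimes Y_l^n)\rangle$. For fixed $l,J$ one has $[J(jl)]\neq0$ for only finitely many $j$. Matrix elements: $\langle JM|f|ln\rangle=\langle Y_J^M|f(Y_l^n)\rangle$ for linear $f:V_l\to V_J$, and likewise $\langle JM|c|JM'\rangle=\langle Y_J^M|c(Y_J^{M'})\rangle$. *)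

theory Defs
  imports "HOL-Analysis.Analysis" "HOL-Library.Function_Algebras"
begin

section \<open>The scalars: the real or the complex numbers\<close>

text \<open>
  The axioms leave exactly the two cases \<open>imag_unit = 0\<close> (the real numbers, with trivial conjugation)
  and \<open>imag_unit * imag_unit = - 1\<close> (the complex numbers).
\<close>

class rc_field = real_normed_field + banach + second_countable_topology +
  fixes rcnj :: "'a \<Rightarrow> 'a"
    and imag_unit :: "'a"
  assumes imag_unit_cases: "imag_unit = 0 \<or> imag_unit * imag_unit = - 1"
    and rc_decomposition: "\<exists>a b. z = scaleR a 1 + scaleR b imag_unit"
    and rcnj_rc: "rcnj (scaleR a 1 + scaleR b imag_unit) = scaleR a 1 - scaleR b imag_unit"
    and mult_rcnj: "z * rcnj z = scaleR ((norm z)\<^sup>2) 1"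

instantiation real :: rc_field
begin

definition rcnj_real :: "real \<Rightarrow> real" where "rcnj_real x = x"
definition imag_unit_real :: real where "imag_unit_real = 0"

instance
  by standard (simp_all add: rcnj_real_def imag_unit_real_def power2_eq_square)

end

instantiation complex :: rc_field
begin

definition rcnj_complex :: "complex \<Rightarrow> complex" where "rcnj_complex = cnj"
definition imag_unit_complex :: complex where "imag_unit_complex = \<i>"

instance
proof
  fix z :: complex
  have "z = scaleR (Re z) 1 + scaleR (Im z) imag_unit"
    by (simp add: imag_unit_complex_def complex_eq_iff)
  then show "\<exists>a b. z = scaleR a 1 + scaleR b imag_unit"
    by blast
  show "z * rcnj z = scaleR ((norm z)\<^sup>2) 1"
    by (simp add: rcnj_complex_def complex_eq_iff cmod_power2 flip: power2_eq_square)
qed (simp_all add: rcnj_complex_def imag_unit_complex_def complex_eq_iff)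

end


section \<open>Linear algebra on subspaces of an ambient vector space\<close>

text \<open>
  Vector spaces are subspaces of ambient types, so that families such as \<open>(V\<^sub>j)\<close> can have
  members of different dimension; \<open>smul\<close> is the scalar multiplication of the ambient type.
\<close>

definition fscale :: "('k \<Rightarrow> 'v \<Rightarrow> 'v) \<Rightarrow> 'k \<Rightarrow> ('a \<Rightarrow> 'v) \<Rightarrow> ('a \<Rightarrow> 'v)" where
  "fscale smul a f = (\<lambda>x. smul a (f x))"

definition linear_on ::
  "('k \<Rightarrow> 'v \<Rightarrow> 'v) \<Rightarrow> ('k \<Rightarrow> 'w \<Rightarrow> 'w) \<Rightarrow> 'v::ab_group_add set \<Rightarrow> 'w::ab_group_add set
    \<Rightarrow> ('v \<Rightarrow> 'w) \<Rightarrow> bool" where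
  "linear_on smul smul' V W f \<longleftrightarrow>
     (\<forall>v\<in>V. f v \<in> W) \<and>
     (\<forall>u\<in>V. \<forall>v\<in>V. f (u + v) = f u + f v) \<and>
     (\<forall>a. \<forall>v\<in>V. f (smul a v) = smul' a (f v))"

text \<open>
  Linear maps \<open>V \<Rightarrow> W\<close> are represented by functions vanishing outside \<open>V\<close>, so that equality of
  functions is equality of linear maps and the pointwise operations are those of \<open>Hom(V, W)\<close>.
\<close>

definition Hom_space ::
  "('k \<Rightarrow> 'v \<Rightarrow> 'v) \<Rightarrow> 'v::ab_group_add set \<Rightarrow> 'v set \<Rightarrow> ('v \<Rightarrow> 'v) set" where
  "Hom_space smul V W = {f. linear_on smul smul V W f \<and> (\<forall>v. v \<notin> V \<longrightarrow> f v = 0)}"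

definition direct_sum :: "'i set \<Rightarrow> ('i \<Rightarrow> 'v::zero set) \<Rightarrow> ('i \<Rightarrow> 'v) set" where
  "direct_sum I A =
     {x. (\<forall>i\<in>I. x i \<in> A i) \<and> (\<forall>i. i \<notin> I \<longrightarrow> x i = 0) \<and> finite {i. x i \<noteq> 0}}"

definition direct_sum_inner ::
  "('i \<Rightarrow> 'v \<Rightarrow> 'v \<Rightarrow> 'k) \<Rightarrow> ('i \<Rightarrow> 'v::zero) \<Rightarrow> ('i \<Rightarrow> 'v) \<Rightarrow> 'k::comm_monoid_add" where
  "direct_sum_inner ip x y = (\<Sum>i\<in>{i. x i \<noteq> 0}. ip i (x i) (y i))"

definition bilinear_form_on ::
  "('k::field \<Rightarrow> 'v \<Rightarrow> 'v) \<Rightarrow> 'v::ab_group_add set \<Rightarrow> 'v set \<Rightarrow> ('v \<Rightarrow> 'v \<Rightarrow> 'k) \<Rightarrow> bool" where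
  "bilinear_form_on smul V W B \<longleftrightarrow>
     (\<forall>v\<in>V. linear_on smul (*) W UNIV (B v)) \<and>
     (\<forall>w\<in>W. linear_on smul (*) V UNIV (\<lambda>v. B v w))"

text \<open>
  The tensor product of \<open>V\<close> and \<open>W\<close> is realised inside the dual of the space of bilinear forms on
  \<open>V \<times> W\<close>: the pure tensor of \<open>v\<close> and \<open>w\<close> is evaluation at \<open>(v, w)\<close>, and \<open>tensor_space\<close> is the span
  of the pure tensors.
\<close>

definition tensor ::
  "('k::field \<Rightarrow> 'v \<Rightarrow> 'v) \<Rightarrow> 'v::ab_group_add set \<Rightarrow> 'v set \<Rightarrow> 'v \<Rightarrow> 'v
    \<Rightarrow> (('v \<Rightarrow> 'v \<Rightarrow> 'k) \<Rightarrow> 'k)" where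
  "tensor smul V W v w = (\<lambda>B. if bilinear_form_on smul V W B then B v w else 0)"

definition tensor_space ::
  "('k::field \<Rightarrow> 'v \<Rightarrow> 'v) \<Rightarrow> 'v::ab_group_add set \<Rightarrow> 'v set \<Rightarrow> (('v \<Rightarrow> 'v \<Rightarrow> 'k) \<Rightarrow> 'k) set" where
  "tensor_space smul V W =
     module.span (fscale (*)) {t. \<exists>v\<in>V. \<exists>w\<in>W. t = tensor smul V W v w}"

definition tensor_map ::
  "('k::field \<Rightarrow> 'v \<Rightarrow> 'v) \<Rightarrow> 'v::ab_group_add set \<Rightarrow> 'v set \<Rightarrow> ('v \<Rightarrow> 'v) \<Rightarrow> ('v \<Rightarrow> 'v)
    \<Rightarrow> (('v \<Rightarrow> 'v \<Rightarrow> 'k) \<Rightarrow> 'k) \<Rightarrow> (('v \<Rightarrow> 'v \<Rightarrow> 'k) \<Rightarrow> 'k)" where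
  "tensor_map smul V W f h t =
     (\<lambda>B. if bilinear_form_on smul V W B then t (\<lambda>v w. B (f v) (h w)) else 0)"

lemma tensor_map_tensor:
  assumes "linear_on smul smul V V f" and "linear_on smul smul W W h"
  shows "tensor_map smul V W f h (tensor smul V W v w) = tensor smul V W (f v) (h w)"
  using assms
  by (auto simp: fun_eq_iff tensor_map_def tensor_def bilinear_form_on_def linear_on_def)


section \<open>Unitary representations\<close>

text \<open>
  The group type is of class \<^class>\<open>topological_group_add\<close>, which is not assumed commutative:
  \<open>g + h\<close> is the group operation, \<open>0\<close> the neutral element, \<open>- g\<close> the inverse.
\<close>

record ('g, 'v, 'k) rep =
  rspace :: "'v set"
  rinner :: "'v \<Rightarrow> 'v \<Rightarrow> 'k"
  raction :: "'g \<Rightarrow> 'v \<Rightarrow> 'v"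

definition inner_product_on ::
  "('k::rc_field \<Rightarrow> 'v \<Rightarrow> 'v) \<Rightarrow> 'v::ab_group_add set \<Rightarrow> ('v \<Rightarrow> 'v \<Rightarrow> 'k) \<Rightarrow> bool" where
  "inner_product_on smul V ip \<longleftrightarrow>
     (\<forall>u\<in>V. linear_on smul (*) V UNIV (ip u)) \<and>
     (\<forall>u\<in>V. \<forall>v\<in>V. ip u v = rcnj (ip v u)) \<and>
     (\<forall>v\<in>V. v \<noteq> 0 \<longrightarrow> (\<exists>r>0. ip v v = of_real r))"

definition rnorm :: "('g, 'v, 'k::rc_field) rep \<Rightarrow> 'v \<Rightarrow> real" where
  "rnorm R v = sqrt (norm (rinner R v v))"

definition unitary_rep ::
  "('k::rc_field \<Rightarrow> 'v \<Rightarrow> 'v) \<Rightarrow> ('g::topological_group_add, 'v::ab_group_add, 'k) rep \<Rightarrow> bool" where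
  "unitary_rep smul R \<longleftrightarrow>
     module.subspace smul (rspace R) \<and>
     (\<exists>B. finite B \<and> rspace R = module.span smul B) \<and>
     inner_product_on smul (rspace R) (rinner R) \<and>
     (\<forall>g. linear_on smul smul (rspace R) (rspace R) (raction R g)) \<and>
     (\<forall>v\<in>rspace R. raction R 0 v = v) \<and>
     (\<forall>g h. \<forall>v\<in>rspace R. raction R (g + h) v = raction R g (raction R h v)) \<and>
     (\<forall>g. \<forall>u\<in>rspace R. \<forall>v\<in>rspace R. rinner R (raction R g u) (raction R g v) = rinner R u v) \<and>
     (\<forall>v\<in>rspace R. \<forall>g. ((\<lambda>h. rnorm R (raction R h v - raction R g v)) \<longlongrightarrow> 0) (at g))"

definition irreducible_unitary_rep ::
  "('k::rc_field \<Rightarrow> 'v \<Rightarrow> 'v) \<Rightarrow> ('g::topological_group_add, 'v::ab_group_add, 'k) rep \<Rightarrow> bool" where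
  "irreducible_unitary_rep smul R \<longleftrightarrow>
     unitary_rep smul R \<and> rspace R \<noteq> {0} \<and>
     (\<forall>U. module.subspace smul U \<and> U \<subseteq> rspace R \<and> (\<forall>g. \<forall>u\<in>U. raction R g u \<in> U)
        \<longrightarrow> U = {0} \<or> U = rspace R)"

definition rep_isomorphic ::
  "('k \<Rightarrow> 'v \<Rightarrow> 'v) \<Rightarrow> ('k \<Rightarrow> 'w \<Rightarrow> 'w) \<Rightarrow> ('g, 'v::ab_group_add, 'k) rep
    \<Rightarrow> ('g, 'w::ab_group_add, 'k) rep \<Rightarrow> bool" where
  "rep_isomorphic smul smul' R S \<longleftrightarrow>
     (\<exists>f. linear_on smul smul' (rspace R) (rspace S) f \<and> bij_betw f (rspace R) (rspace S) \<and>
        (\<forall>g. \<forall>v\<in>rspace R. f (raction R g v) = raction S g (f v)))"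

text \<open>
  The index type \<open>'j\<close> plays the role of \<open>\<widehat>G\<close>. Irreducible unitary
  representations of a compact group are finite-dimensional, so each of them is isomorphic to one on
  a subspace of \<^typ>\<open>nat \<Rightarrow> 'k\<close>; exhaustiveness is therefore tested against representations on
  such subspaces (with an arbitrary inner product).
\<close>

definition irrep_representatives ::
  "('k::rc_field \<Rightarrow> 'v \<Rightarrow> 'v)
    \<Rightarrow> ('j \<Rightarrow> ('g::topological_group_add, 'v::ab_group_add, 'k) rep) \<Rightarrow> bool" where
  "irrep_representatives smul R \<longleftrightarrow>
     (\<forall>j. irreducible_unitary_rep smul (R j)) \<and>
     (\<forall>j j'. rep_isomorphic smul smul (R j) (R j') \<longrightarrow> j = j') \<and>
     (\<forall>S :: ('g, nat \<Rightarrow> 'k, 'k) rep. irreducible_unitary_rep (fscale (*)) S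
        \<longrightarrow> (\<exists>j. rep_isomorphic smul (fscale (*)) (R j) S))"

definition rdim :: "('k::field \<Rightarrow> 'v::ab_group_add \<Rightarrow> 'v) \<Rightarrow> ('g, 'v, 'k) rep \<Rightarrow> nat" where
  "rdim smul R = vector_space.dim smul (rspace R)"

text \<open>All indices are zero-based: \<open>m < d\<^sub>j\<close> stands for \<open>1 \<le> m \<le> d\<^sub>j\<close>, and so on.\<close>

definition orthonormal_basis ::
  "('k::rc_field \<Rightarrow> 'v \<Rightarrow> 'v) \<Rightarrow> ('g, 'v::ab_group_add, 'k) rep \<Rightarrow> (nat \<Rightarrow> 'v) \<Rightarrow> bool" where
  "orthonormal_basis smul R Y \<longleftrightarrow>
     (\<forall>m<rdim smul R. Y m \<in> rspace R) \<and>
     (\<forall>m<rdim smul R. \<forall>n<rdim smul R. rinner R (Y m) (Y n) = (if m = n then 1 else 0)) \<and>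
     module.span smul (Y ` {..<rdim smul R}) = rspace R"

definition End_G ::
  "('k \<Rightarrow> 'v \<Rightarrow> 'v) \<Rightarrow> ('g, 'v::ab_group_add, 'k) rep \<Rightarrow> ('v \<Rightarrow> 'v) set" where
  "End_G smul R =
     {c \<in> Hom_space smul (rspace R) (rspace R).
        \<forall>g. \<forall>v\<in>rspace R. c (raction R g v) = raction R g (c v)}"


section \<open>Homogeneous spaces and harmonic basis functions\<close>

definition homogeneous_space ::
  "('g::topological_group_add \<Rightarrow> 'x::t2_space \<Rightarrow> 'x) \<Rightarrow> bool" where
  "homogeneous_space act \<longleftrightarrow>
     (\<forall>x. act 0 x = x) \<and>
     (\<forall>g h x. act (g + h) x = act g (act h x)) \<and>
     continuous_on UNIV (\<lambda>(g, x). act g x) \<and>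
     (\<forall>x y. \<exists>g. act g x = y)"

text \<open>
  Regularity is part of the notion because uniqueness of the normalized invariant measure holds
  among regular Borel measures when the space is not second countable.
\<close>

definition invariant_measure ::
  "('g \<Rightarrow> 'x::t2_space \<Rightarrow> 'x) \<Rightarrow> 'x measure \<Rightarrow> bool" where
  "invariant_measure act \<mu> \<longleftrightarrow>
     sets \<mu> = sets borel \<and> emeasure \<mu> UNIV = 1 \<and>
     (\<forall>g. distr \<mu> borel (act g) = \<mu>) \<and>
     (\<forall>A\<in>sets borel. emeasure \<mu> A = (SUP C\<in>{C. compact C \<and> C \<subseteq> A}. emeasure \<mu> C))"

definition square_integrable :: "'x measure \<Rightarrow> ('x \<Rightarrow> 'k::rc_field) \<Rightarrow> bool" where
  "square_integrable \<mu> f \<longleftrightarrow>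
     f \<in> borel_measurable \<mu> \<and> integrable \<mu> (\<lambda>x. (norm (f x))\<^sup>2)"

definition L2_orthonormal_basis ::
  "'x measure \<Rightarrow> 'i set \<Rightarrow> ('i \<Rightarrow> 'x \<Rightarrow> 'k::rc_field) \<Rightarrow> bool" where
  "L2_orthonormal_basis \<mu> I b \<longleftrightarrow>
     (\<forall>i\<in>I. square_integrable \<mu> (b i)) \<and>
     (\<forall>i\<in>I. \<forall>i'\<in>I. (LINT x|\<mu>. rcnj (b i x) * b i' x) = (if i = i' then 1 else 0)) \<and>
     (\<forall>f. square_integrable \<mu> f \<longrightarrow>
        (\<forall>\<epsilon>>0. \<exists>F a. finite F \<and> F \<subseteq> I \<and>
           (LINT x|\<mu>. (norm (f x - (\<Sum>i\<in>F. a i * b i x)))\<^sup>2) < \<epsilon>))"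

text \<open>\<open>H j i m\<close> is the function \<open>Y\<^sub>j\<^sub>i\<^sup>m\<close> and \<open>mh j\<close> the number \<open>m\<^sub>j\<close>.\<close>

definition harmonic_basis ::
  "('k::rc_field \<Rightarrow> 'v \<Rightarrow> 'v)
    \<Rightarrow> ('g::topological_group_add \<Rightarrow> 'x::t2_space \<Rightarrow> 'x) \<Rightarrow> 'x measure
    \<Rightarrow> ('j \<Rightarrow> ('g, 'v::ab_group_add, 'k) rep) \<Rightarrow> ('j \<Rightarrow> nat \<Rightarrow> 'v)
    \<Rightarrow> ('j \<Rightarrow> nat) \<Rightarrow> ('j \<Rightarrow> nat \<Rightarrow> nat \<Rightarrow> 'x \<Rightarrow> 'k) \<Rightarrow> bool" where
  "harmonic_basis smul act \<mu> R Y mh H \<longleftrightarrow>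
     (\<forall>j. mh j \<le> rdim smul (R j)) \<and>
     (\<forall>j. \<forall>i<mh j. \<forall>m<rdim smul (R j). \<forall>g x.
        H j i m (act (- g) x) =
          (\<Sum>m'<rdim smul (R j).
             rinner (R j) (Y j m') (raction (R j) g (Y j m)) * H j i m' x)) \<and>
     L2_orthonormal_basis \<mu>
       {(j, i, m). i < mh j \<and> m < rdim smul (R j)} (\<lambda>(j, i, m). H j i m)"


section \<open>Clebsch-Gordan coefficients\<close>

text \<open>
  \<open>cgm J j l\<close> is the multiplicity \<open>[J(jl)]\<close>; it is determined by the requirement that \<open>CG j l\<close> be an
  equivariant isomorphism onto the direct sum with \<open>cgm J j l\<close> copies of each \<open>V\<^sub>J\<close>.
\<close>

definition clebsch_gordan ::
  "('k::rc_field \<Rightarrow> 'v \<Rightarrow> 'v) \<Rightarrow> ('j \<Rightarrow> ('g, 'v::ab_group_add, 'k) rep)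
    \<Rightarrow> ('j \<Rightarrow> 'j \<Rightarrow> 'j \<Rightarrow> nat)
    \<Rightarrow> ('j \<Rightarrow> 'j \<Rightarrow> (('v \<Rightarrow> 'v \<Rightarrow> 'k) \<Rightarrow> 'k) \<Rightarrow> ('j \<times> nat \<Rightarrow> 'v)) \<Rightarrow> bool" where
  "clebsch_gordan smul R cgm CG \<longleftrightarrow>
     (\<forall>j l.
        let T = tensor_space smul (rspace (R j)) (rspace (R l));
            D = direct_sum {(J, s). s < cgm J j l} (\<lambda>(J, s). rspace (R J))
        in linear_on (fscale (*)) (fscale smul) T D (CG j l) \<and> bij_betw (CG j l) T D \<and>
           (\<forall>g. \<forall>t\<in>T.
              CG j l (tensor_map smul (rspace (R j)) (rspace (R l))
                        (raction (R j) g) (raction (R l) g) t)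
              = (\<lambda>(J, s). raction (R J) g (CG j l t (J, s)))))"

text \<open>\<open>cg_coeff smul R Y CG s J M j m l n\<close> is \<open>\<langle>s, JM | jm; ln\<rangle>\<close>.\<close>

definition cg_coeff ::
  "('k::rc_field \<Rightarrow> 'v \<Rightarrow> 'v) \<Rightarrow> ('j \<Rightarrow> ('g, 'v::ab_group_add, 'k) rep) \<Rightarrow> ('j \<Rightarrow> nat \<Rightarrow> 'v)
    \<Rightarrow> ('j \<Rightarrow> 'j \<Rightarrow> (('v \<Rightarrow> 'v \<Rightarrow> 'k) \<Rightarrow> 'k) \<Rightarrow> ('j \<times> nat \<Rightarrow> 'v))
    \<Rightarrow> nat \<Rightarrow> 'j \<Rightarrow> nat \<Rightarrow> 'j \<Rightarrow> nat \<Rightarrow> 'j \<Rightarrow> nat \<Rightarrow> 'k" where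
  "cg_coeff smul R Y CG s J M j m l n =
     direct_sum_inner (\<lambda>(J', s'). rinner (R J'))
       ((\<lambda>_. 0)((J, s) := Y J M))
       (CG j l (tensor smul (rspace (R j)) (rspace (R l)) (Y j m) (Y l n)))"


section \<open>Steerable kernels\<close>

definition steerable_kernels ::
  "('k \<Rightarrow> 'v \<Rightarrow> 'v) \<Rightarrow> ('g::topological_group_add \<Rightarrow> 'x \<Rightarrow> 'x)
    \<Rightarrow> ('g, 'v::ab_group_add, 'k) rep \<Rightarrow> ('g, 'v, 'k) rep \<Rightarrow> ('x \<Rightarrow> 'v \<Rightarrow> 'v) set" where
  "steerable_kernels smul act Rin Rout =
     {K. (\<forall>x. K x \<in> Hom_space smul (rspace Rin) (rspace Rout)) \<and>
         (\<forall>g x. \<forall>v\<in>rspace Rin.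
            K (act g x) v = raction Rout g (K x (raction Rin (- g) v)))}"

end

theory Submission
  imports Defs
begin

text \<open>
  The vector \<open>w\<^sub>j\<^sub>i(x) = \<Sum>\<^sub>m \<langle>i,jm|x\<rangle> Y\<^sub>j\<^sup>m\<close> depends equivariantly on \<open>x\<close>, so every equivariant bilinear map
  \<open>\<beta> : V\<^sub>j \<times> V\<^sub>l \<rightarrow> V\<^sub>J\<close> yields a steerable kernel \<open>x \<mapsto> \<beta>(w\<^sub>j\<^sub>i(x), -)\<close>. By Schur's lemma and the
  Clebsch-Gordan isomorphism such a \<open>\<beta>\<close> is the same as a family of \<open>[J(jl)]\<close> endomorphisms of \<open>V\<^sub>J\<close>,
  and it can be nonzero for finitely many \<open>j\<close> only, since non-isomorphic irreducible subspaces of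
  \<open>Hom(V\<^sub>l, V\<^sub>J)\<close> are independent. The bilinear map is recovered from a kernel \<open>K\<close> as the Fourier
  coefficient \<open>\<integral> Y\<^sub>j\<^sub>i\<^sup>m(x) K(x) dx\<close>, which gives injectivity. Conversely, subtracting from a kernel the
  one built from its Fourier coefficients leaves a kernel orthogonal to all harmonics; it vanishes
  almost everywhere, hence at some point, hence everywhere by transitivity.
\<close>

section \<open>Conjugation\<close>

text \<open>Kernels are arbitrary functions on X, with no measurability assumed. The steering law
  along an orbit writes their matrix elements as finite combinations of matrix elements of the input
  and output representations; this makes them continuous, and only then do the Fourier coefficients
  exist. Over the reals an irreducible representation may have equivariant endomorphisms other than
  scalars, so Schur's lemma is applied between different indices only and the endomorphisms of the
  output space stay in the answer. The vector w_ji(x) carries conjugated harmonics: the harmonics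
  transform under the inverse of g by the matrix of g, and unitarity turns the conjugated family
  into a covariant one. Finiteness in j serves twice: the sum that defines a kernel is finite, and
  the direct sum over (j, i, s) has a finite index set, so the blocks found from a given kernel can
  be assembled with no question of convergence.\<close>

lemma rcnj_add: "rcnj (x + y) = rcnj x + rcnj (y::'k::rc_field)"
proof -
  obtain a b where x: "x = scaleR a 1 + scaleR b imag_unit" using rc_decomposition by blast
  obtain c d where y: "y = scaleR c 1 + scaleR d imag_unit" using rc_decomposition by blast
  \<comment> \<open>When \<open>imag_unit = 0\<close> the coordinates are not unique, but
    \<open>rcnj_rc\<close> applies to any decomposition, so this one will do.\<close>
  have "x + y = scaleR (a + c) 1 + scaleR (b + d) imag_unit"
    by (simp add: x y scaleR_add_left algebra_simps)
  then have "rcnj (x + y) = scaleR (a + c) 1 - scaleR (b + d) imag_unit"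
    by (simp only: rcnj_rc)
  then show ?thesis
    unfolding x y rcnj_rc by (simp add: scaleR_add_left algebra_simps)
qed

lemma rcnj_diff: "rcnj (x - y) = rcnj x - rcnj (y::'k::rc_field)"
  using rcnj_add[of "x - y" y] by simp

lemma rcnj_scaleR: "rcnj (scaleR r x) = scaleR r (rcnj (x::'k::rc_field))"
proof -
  obtain a b where x: "x = scaleR a 1 + scaleR b imag_unit" using rc_decomposition by blast
  have "scaleR r x = scaleR (r * a) 1 + scaleR (r * b) imag_unit"
    by (simp add: x scaleR_add_right)
  then have "rcnj (scaleR r x) = scaleR (r * a) 1 - scaleR (r * b) imag_unit"
    by (simp only: rcnj_rc)
  then show ?thesis
    unfolding x rcnj_rc by (simp add: scaleR_diff_right)
qed

lemma rcnj_rcnj [simp]: "rcnj (rcnj x) = (x::'k::rc_field)"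
proof -
  obtain a b where x: "x = scaleR a 1 + scaleR b imag_unit" using rc_decomposition by blast
  have "rcnj x = scaleR a 1 + scaleR (- b) imag_unit"
    unfolding x rcnj_rc by simp
  then show ?thesis
    using rcnj_rc[of a "- b"] x by simp
qed

lemma rcnj_of_real [simp]: "rcnj (of_real r) = (of_real r :: 'k::rc_field)"
  using rcnj_rc[of r 0] by (simp add: of_real_def)

lemma rcnj_0 [simp]: "rcnj 0 = (0::'k::rc_field)"
  using rcnj_of_real[of 0] by simp

text \<open>Both products are the same expression in \<open>imag_unit * imag_unit\<close> up to the
  sign of the linear term. This square is 0 or -1, and in each case the product gets coordinates
  whose conjugate is known.\<close>

lemma rcnj_mult: "rcnj (x * y) = rcnj x * rcnj (y::'k::rc_field)"
proof -
  obtain a b where x: "x = scaleR a 1 + scaleR b imag_unit" using rc_decomposition by blast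
  obtain c d where y: "y = scaleR c 1 + scaleR d imag_unit" using rc_decomposition by blast
  have *: "x * y = scaleR (a * c) 1 + scaleR (b * d) (imag_unit * imag_unit)
      + scaleR (a * d + b * c) imag_unit"
    by (simp add: x y algebra_simps)
  have **: "rcnj x * rcnj y = scaleR (a * c) 1 + scaleR (b * d) (imag_unit * imag_unit)
      - scaleR (a * d + b * c) imag_unit"
    unfolding x y rcnj_rc by (simp add: algebra_simps)
  show ?thesis
  proof (cases "imag_unit = (0::'k)")
    case True
    then show ?thesis
      using * ** rcnj_of_real[of "a * c"] by (simp add: of_real_def)
  next
    case False
    then have "imag_unit * imag_unit = - (1::'k)"
      using imag_unit_cases by blast
    then have "x * y = scaleR (a * c - b * d) 1 + scaleR (a * d + b * c) imag_unit"
      "rcnj x * rcnj y = scaleR (a * c - b * d) 1 - scaleR (a * d + b * c) imag_unit"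
      using * ** by (simp_all add: scaleR_diff_left)
    then show ?thesis
      by (simp only: rcnj_rc)
  qed
qed

lemma norm_rcnj [simp]: "norm (rcnj x) = norm (x::'k::rc_field)"
proof (cases "x = 0")
  case False
  have "norm x * norm (rcnj x) = (norm x)\<^sup>2"
    using arg_cong[OF mult_rcnj[of x], of norm] by (simp add: norm_mult)
  then show ?thesis
    using False by (simp add: power2_eq_square)
qed simp

lemma rcnj_sum: "rcnj (sum f A) = (\<Sum>a\<in>A. rcnj (f a :: 'k::rc_field))"
  by (induction A rule: infinite_finite_induct) (simp_all add: rcnj_add)

lemma rcnj_eq_0_iff [simp]: "rcnj x = 0 \<longleftrightarrow> x = (0::'k::rc_field)"
  by (metis norm_rcnj norm_eq_zero)

lemma bounded_linear_rcnj: "bounded_linear (rcnj :: 'k::rc_field \<Rightarrow> 'k)"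
  by (rule bounded_linear_intro[where K = 1]) (simp_all add: rcnj_add rcnj_scaleR)

lemma norm_power2_rc: "of_real ((norm x)\<^sup>2) = rcnj x * (x::'k::rc_field)"
  using mult_rcnj[of x] by (simp add: of_real_def mult.commute)

lemma integral_rcnj: "(LINT x|M. rcnj (f x)) = rcnj (LINT x|M. (f x::'k::rc_field))"
proof (cases "integrable M f")
  case True
  then show ?thesis by (rule integral_bounded_linear[OF bounded_linear_rcnj])
next
  case False
  \<comment> \<open>The Bochner integral of a non-integrable function is 0 by convention.
    Conjugation is an involution, so both sides take this default together.\<close>
  have "\<not> integrable M (\<lambda>x. rcnj (f x))"
  proof
    assume "integrable M (\<lambda>x. rcnj (f x))"
    from integrable_bounded_linear[OF bounded_linear_rcnj this] False show False by simp
  qed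
  then show ?thesis using False by (simp add: not_integrable_integral_eq)
qed

lemma integrable_rcnj: "integrable M f \<Longrightarrow> integrable M (\<lambda>x. rcnj (f x :: 'k::rc_field))"
  by (rule integrable_bounded_linear[OF bounded_linear_rcnj])

lemma borel_measurable_rcnj:
  "f \<in> borel_measurable M \<Longrightarrow> (\<lambda>x. rcnj (f x :: 'k::rc_field)) \<in> borel_measurable M"
  by (rule borel_measurable_continuous_on[OF linear_continuous_on[OF bounded_linear_rcnj]])

section \<open>Square-integrable functions\<close>

lemma square_integrable_rcnj:
  "square_integrable M f \<Longrightarrow> square_integrable M (\<lambda>x. rcnj (f x :: 'k::rc_field))"
  by (simp add: square_integrable_def borel_measurable_rcnj)

text \<open>The arithmetic-geometric mean inequality dominates the product pointwise by the sum of
  the squared norms.\<close>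

lemma square_integrable_mult:
  fixes f g :: "'x \<Rightarrow> 'k::rc_field"
  assumes f: "square_integrable M f" and g: "square_integrable M g"
  shows "integrable M (\<lambda>x. f x * g x)"
proof (rule Bochner_Integration.integrable_bound)
  show "integrable M (\<lambda>x. (norm (f x))\<^sup>2 + (norm (g x))\<^sup>2)"
    using f g by (simp add: square_integrable_def)
  show "(\<lambda>x. f x * g x) \<in> borel_measurable M"
    using f g unfolding square_integrable_def by (intro borel_measurable_times) auto
  have "norm (f x * g x) \<le> norm ((norm (f x))\<^sup>2 + (norm (g x))\<^sup>2)" for x
  proof -
    have "2 * (norm (f x) * norm (g x)) \<le> (norm (f x))\<^sup>2 + (norm (g x))\<^sup>2"
      using sum_squares_bound[of "norm (f x)" "norm (g x)"] by (simp add: algebra_simps)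
    moreover have "0 \<le> norm (f x) * norm (g x)" by simp
    ultimately have "norm (f x) * norm (g x) \<le> (norm (f x))\<^sup>2 + (norm (g x))\<^sup>2"
      by linarith
    then show ?thesis by (simp add: norm_mult)
  qed
  then show "AE x in M. norm (f x * g x) \<le> norm ((norm (f x))\<^sup>2 + (norm (g x))\<^sup>2)" by simp
qed

lemma integral_norm_power2:
  fixes f :: "'x \<Rightarrow> 'k::rc_field"
  assumes "integrable M (\<lambda>x. rcnj (f x) * f x)"
  shows "of_real (LINT x|M. (norm (f x))\<^sup>2) = (LINT x|M. rcnj (f x) * f x)"
proof -
  have "integrable M (\<lambda>x. (norm (f x))\<^sup>2)"
    using integrable_norm[OF assms] by (simp add: norm_mult power2_eq_square)
  then show ?thesis
    unfolding norm_power2_rc[symmetric] by (rule integral_of_real[symmetric])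
qed

text \<open>By Pythagoras, a function orthogonal to all \<open>b i\<close> is at distance at least
  its own norm from every finite combination of them, while density makes this distance arbitrarily
  small.\<close>

lemma L2_orthonormal_basis_complete:
  fixes f :: "'x \<Rightarrow> 'k::rc_field"
  assumes b: "L2_orthonormal_basis M I b" and f: "square_integrable M f"
    and orth: "\<And>i. i \<in> I \<Longrightarrow> (LINT x|M. rcnj (f x) * b i x) = 0"
  shows "AE x in M. f x = 0"
proof -
  have bsq: "square_integrable M (b i)" if "i \<in> I" for i
    using b that by (simp add: L2_orthonormal_basis_def)
  have le: "(LINT x|M. (norm (f x))\<^sup>2) \<le> (LINT x|M. (norm (f x - (\<Sum>i\<in>F. a i * b i x)))\<^sup>2)"
    if F: "finite F" "F \<subseteq> I" for F a
  proof -
    define s where "s x = (\<Sum>i\<in>F. a i * b i x)" for x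
    have fb: "integrable M (\<lambda>x. rcnj (f x) * b i x)" if "i \<in> F" for i
      by (rule square_integrable_mult[OF square_integrable_rcnj[OF f] bsq]) (use that F in auto)
    have fs: "(\<lambda>x. rcnj (f x) * s x) = (\<lambda>x. \<Sum>i\<in>F. a i * (rcnj (f x) * b i x))"
      by (simp add: s_def sum_distrib_left mult_ac fun_eq_iff)
    have fsi: "integrable M (\<lambda>x. rcnj (f x) * s x)"
      unfolding fs using fb by auto
    have fs0: "(LINT x|M. rcnj (f x) * s x) = 0"
      unfolding fs using fb orth F by (subst Bochner_Integration.integral_sum) (auto simp: subset_iff)
    have sfi: "integrable M (\<lambda>x. rcnj (s x) * f x)"
      using integrable_rcnj[OF fsi] by (simp add: rcnj_mult mult.commute)
    have sf0: "(LINT x|M. rcnj (s x) * f x) = 0"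
      using integral_rcnj[of M "\<lambda>x. rcnj (f x) * s x"] fs0 by (simp add: rcnj_mult mult.commute)
    have ss: "(\<lambda>x. rcnj (s x) * s x)
        = (\<lambda>x. \<Sum>i\<in>F. \<Sum>k\<in>F. rcnj (a i) * a k * (rcnj (b i x) * b k x))"
      by (simp only: s_def rcnj_sum sum_product) (simp add: rcnj_mult mult_ac)
    have ssi: "integrable M (\<lambda>x. rcnj (s x) * s x)"
      unfolding ss using F
      by (intro Bochner_Integration.integrable_sum integrable_mult_right square_integrable_mult square_integrable_rcnj bsq)
         auto
    have ffi: "integrable M (\<lambda>x. rcnj (f x) * f x)"
      by (rule square_integrable_mult[OF square_integrable_rcnj[OF f] f])
    have eq: "(\<lambda>x. rcnj (f x - s x) * (f x - s x))
        = (\<lambda>x. rcnj (f x) * f x - rcnj (s x) * f x - rcnj (f x) * s x + rcnj (s x) * s x)"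
      by (simp add: rcnj_diff algebra_simps)
    \<comment> \<open>The square is expanded among the scalars, where it is a product with a
      conjugate; injectivity of \<open>of_real\<close> brings the identity back to the
      reals.\<close>
    have "of_real (LINT x|M. (norm (f x - s x))\<^sup>2) = (LINT x|M. rcnj (f x - s x) * (f x - s x))"
      using fsi sfi ssi ffi by (intro integral_norm_power2) (simp add: eq)
    also have "\<dots> = (LINT x|M. rcnj (f x) * f x) + (LINT x|M. rcnj (s x) * s x)"
      unfolding eq using fsi sfi ssi ffi by (simp add: fs0 sf0)
    also have "\<dots> = of_real ((LINT x|M. (norm (f x))\<^sup>2) + (LINT x|M. (norm (s x))\<^sup>2))"
      using integral_norm_power2[OF ffi] integral_norm_power2[OF ssi] by simp
    finally have "(LINT x|M. (norm (f x - s x))\<^sup>2)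
        = (LINT x|M. (norm (f x))\<^sup>2) + (LINT x|M. (norm (s x))\<^sup>2)"
      by (simp only: of_real_eq_iff)
    moreover have "0 \<le> (LINT x|M. (norm (s x))\<^sup>2)" by simp
    ultimately show ?thesis unfolding s_def by linarith
  qed
  have "(LINT x|M. (norm (f x))\<^sup>2) \<le> e" if "e > 0" for e :: real
  proof -
    obtain F a where "finite F" "F \<subseteq> I" "(LINT x|M. (norm (f x - (\<Sum>i\<in>F. a i * b i x)))\<^sup>2) < e"
      using b f \<open>e > 0\<close> unfolding L2_orthonormal_basis_def by meson
    then show ?thesis using le[of F a] by linarith
  qed
  then have "(LINT x|M. (norm (f x))\<^sup>2) \<le> 0"
    using field_le_epsilon[of "LINT x|M. (norm (f x))\<^sup>2" 0] by auto
  then have "(LINT x|M. (norm (f x))\<^sup>2) = 0"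
    by (intro antisym) simp_all
  then have "AE x in M. (norm (f x))\<^sup>2 = 0"
    using f by (subst (asm) integral_nonneg_eq_0_iff_AE) (auto simp: square_integrable_def)
  then show ?thesis by simp
qed

section \<open>Linear maps on subspaces\<close>

lemma vector_space_fscale:
  assumes "vector_space smul"
  shows "vector_space (fscale smul)"
proof -
  interpret vector_space smul by fact
  show ?thesis
    by unfold_locales (auto simp: fscale_def fun_eq_iff scale_right_distrib scale_left_distrib)
qed

lemma vector_space_times: "vector_space ((*) :: 'k::field \<Rightarrow> 'k \<Rightarrow> 'k)"
  by unfold_locales (auto simp: algebra_simps)

lemma linear_onD:
  assumes "linear_on s s' V W f"
  shows "v \<in> V \<Longrightarrow> f v \<in> W"
    and "u \<in> V \<Longrightarrow> v \<in> V \<Longrightarrow> f (u + v) = f u + f v"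
    and "v \<in> V \<Longrightarrow> f (s a v) = s' a (f v)"
  using assms by (auto simp: linear_on_def)

context
  fixes s :: "'k::field \<Rightarrow> 'v::ab_group_add \<Rightarrow> 'v" and s' :: "'k \<Rightarrow> 'w::ab_group_add \<Rightarrow> 'w"
    and V W f
  assumes vs: "vector_space s" and V: "module.subspace s V" and f: "linear_on s s' V W f"
begin

interpretation vector_space s by (rule vs)

lemma linear_on_0: "f 0 = 0"
  using linear_onD(2)[OF f, of 0 0] subspace_0[OF V] by simp

lemma linear_on_sum:
  assumes "\<And>i. i \<in> I \<Longrightarrow> g i \<in> V"
  shows "f (sum g I) = (\<Sum>i\<in>I. f (g i))"
  using assms
proof (induction I rule: infinite_finite_induct)
  case (insert x F)
  then show ?case
    using linear_onD(2)[OF f, of "g x" "sum g F"] subspace_sum[OF V, of F g] by simp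
qed (simp_all add: linear_on_0)

lemma linear_on_minus: "v \<in> V \<Longrightarrow> f (- v) = - f v"
  using linear_onD(2)[OF f, of v "- v"] subspace_neg[OF V] linear_on_0
  by (simp add: eq_neg_iff_add_eq_0 add.commute)

lemma linear_on_diff: "u \<in> V \<Longrightarrow> v \<in> V \<Longrightarrow> f (u - v) = f u - f v"
  using linear_onD(2)[OF f, of u "- v"] subspace_neg[OF V] linear_on_minus by simp

lemma linear_on_kernel: "subspace {v \<in> V. f v = 0}" if "vector_space s'"
proof -
  interpret s': vector_space s' by fact
  show ?thesis
    using linear_onD[OF f] V by (auto simp: subspace_def linear_on_0)
qed

lemma linear_on_image: "module.subspace s' (f ` V)" if "vector_space s'"
proof -
  interpret s': vector_space s' by fact
  show ?thesis
    unfolding s'.subspace_def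
  proof (intro conjI ballI allI)
    show "0 \<in> f ` V" using linear_on_0 subspace_0[OF V] by (metis imageI)
    show "x + y \<in> f ` V" if "x \<in> f ` V" "y \<in> f ` V" for x y
      using that linear_onD(2)[OF f] subspace_add[OF V] by (auto simp: image_iff) metis
    show "s' a x \<in> f ` V" if "x \<in> f ` V" for a x
      using that linear_onD(3)[OF f] subspace_scale[OF V] by (auto simp: image_iff) metis
  qed
qed

lemma linear_on_inv_into:
  assumes "bij_betw f V W"
  shows "linear_on s' s W V (inv_into V f)"
  unfolding linear_on_def
proof (intro conjI ballI allI)
  have inv: "inv_into V f w \<in> V" "f (inv_into V f w) = w" if "w \<in> W" for w
    using assms that by (auto simp: bij_betw_def inv_into_into f_inv_into_f)
  have inv': "inv_into V f (f v) = v" if "v \<in> V" for v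
    using assms that by (simp add: bij_betw_def)
  fix w w' a assume w: "w \<in> W" 
  show "inv_into V f w \<in> V" by (rule inv[OF w])
  show "inv_into V f (s' a w) = s a (inv_into V f w)"
    using inv'[of "s a (inv_into V f w)"] linear_onD(3)[OF f] inv w subspace_scale[OF V] by metis
  assume w': "w' \<in> W"
  show "inv_into V f (w + w') = inv_into V f w + inv_into V f w'"
    using inv'[of "inv_into V f w + inv_into V f w'"] linear_onD(2)[OF f] inv w w'
      subspace_add[OF V] by metis
qed

end

section \<open>Matrix elements of unitary representations\<close>

locale unirep = vector_space smul
  for smul :: "'k::rc_field \<Rightarrow> 'v::ab_group_add \<Rightarrow> 'v" +
  fixes R :: "('g::topological_group_add, 'v, 'k) rep" and Y :: "nat \<Rightarrow> 'v"
  assumes unitary: "unitary_rep smul R" and onb: "orthonormal_basis smul R Y"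
begin

abbreviation "V \<equiv> rspace R"
abbreviation "ip \<equiv> rinner R"
abbreviation "\<rho> \<equiv> raction R"
abbreviation "d \<equiv> rdim smul R"

lemma subspace_V: "subspace V"
  using unitary unfolding unitary_rep_def by (elim conjE)

lemma action_linear: "linear_on smul smul V V (\<rho> g)"
  using unitary unfolding unitary_rep_def by (elim conjE) (erule spec)

lemma action_0: "v \<in> V \<Longrightarrow> \<rho> 0 v = v"
  using unitary unfolding unitary_rep_def by (elim conjE) (erule bspec)

lemma action_add: "v \<in> V \<Longrightarrow> \<rho> (g + h) v = \<rho> g (\<rho> h v)"
  using unitary unfolding unitary_rep_def by (elim conjE) metis

lemma ip_action: "u \<in> V \<Longrightarrow> v \<in> V \<Longrightarrow> ip (\<rho> g u) (\<rho> g v) = ip u v"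
  using unitary unfolding unitary_rep_def by (elim conjE) metis

lemma action_continuous: "v \<in> V \<Longrightarrow> ((\<lambda>h. rnorm R (\<rho> h v - \<rho> g v)) \<longlongrightarrow> 0) (at g)"
  using unitary unfolding unitary_rep_def by (elim conjE) metis

lemma inner_product: "inner_product_on smul V ip"
  using unitary unfolding unitary_rep_def by (elim conjE)

lemma ip_linear: "u \<in> V \<Longrightarrow> linear_on smul (*) V UNIV (ip u)"
  using inner_product unfolding inner_product_on_def by (elim conjE) (erule bspec)

lemma ip_commute: "u \<in> V \<Longrightarrow> v \<in> V \<Longrightarrow> ip u v = rcnj (ip v u)"
  using inner_product unfolding inner_product_on_def by (elim conjE) (drule (1) bspec, erule bspec)

lemma Y_in [simp]: "m < d \<Longrightarrow> Y m \<in> V"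
  and ip_Y: "m < d \<Longrightarrow> n < d \<Longrightarrow> ip (Y m) (Y n) = (if m = n then 1 else 0)"
  and span_Y: "span (Y ` {..<d}) = V"
  using onb by (auto simp: orthonormal_basis_def)

lemmas zero_in [simp] = subspace_0[OF subspace_V]
  and add_in [simp] = subspace_add[OF subspace_V]
  and diff_in [simp] = subspace_diff[OF subspace_V]
  and scale_in [simp] = subspace_scale[OF subspace_V]
  and sum_in = subspace_sum[OF subspace_V]
  and action_in [simp] = linear_onD(1)[OF action_linear]

lemmas ip_add = linear_onD(2)[OF ip_linear]
  and ip_scale = linear_onD(3)[OF ip_linear]
  and ip_zero = linear_on_0[OF vector_space_axioms subspace_V ip_linear]
  and ip_sum = linear_on_sum[OF vector_space_axioms subspace_V ip_linear]
  and ip_diff = linear_on_diff[OF vector_space_axioms subspace_V ip_linear]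
  and action_plus = linear_onD(2)[OF action_linear]
  and action_scale = linear_onD(3)[OF action_linear]
  and action_zero [simp] = linear_on_0[OF vector_space_axioms subspace_V action_linear]
  and action_sum = linear_on_sum[OF vector_space_axioms subspace_V action_linear]
  and action_diff = linear_on_diff[OF vector_space_axioms subspace_V action_linear]

lemma action_neg [simp]: "v \<in> V \<Longrightarrow> \<rho> (- g) (\<rho> g v) = v" "v \<in> V \<Longrightarrow> \<rho> g (\<rho> (- g) v) = v"
  by (simp_all flip: action_add add: action_0)

lemma Y_nonzero: "m < d \<Longrightarrow> Y m \<noteq> 0"
  using ip_Y[of m m] ip_zero[of "Y m"] by auto

lemma expand: assumes "v \<in> V" shows "v = (\<Sum>m<d. smul (ip (Y m) v) (Y m))"
proof -
  let ?P = "\<lambda>v. (\<Sum>m<d. smul (ip (Y m) v) (Y m))"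
  \<comment> \<open>Membership is carried through the induction because \<open>ip\<close> is linear
    on \<open>V\<close> only.\<close>
  have "v \<in> V \<and> ?P v = v"
    using assms unfolding span_Y[symmetric]
  proof (induction rule: span_induct_alt)
    case base
    show ?case by (auto simp: ip_zero span_Y)
  next
    case (step c x y)
    then obtain n where n: "n < d" "x = Y n" by auto
    have "?P (smul c x + y) = (\<Sum>m<d. smul (if n = m then c else 0) (Y m)) + ?P y"
      unfolding sum.distrib[symmetric]
      using n step by (intro sum.cong) (auto simp: ip_add ip_scale ip_Y span_Y scale_left_distrib)
    also have "(\<Sum>m<d. smul (if n = m then c else 0) (Y m)) = (\<Sum>m<d. if n = m then smul c (Y m) else 0)"
      by (intro sum.cong) auto
    also have "\<dots> = smul c x"
      using n by simp
    finally show ?case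
      using step n by (auto simp: span_Y)
  qed
  then show ?thesis by simp
qed

lemma linear_expand:
  assumes f: "linear_on smul s' V W f" and v: "v \<in> V"
  shows "f v = (\<Sum>m<d. s' (ip (Y m) v) (f (Y m)))"
proof -
  have "f v = f (\<Sum>m<d. smul (ip (Y m) v) (Y m))"
    by (simp only: expand[OF v, symmetric])
  also have "\<dots> = (\<Sum>m<d. s' (ip (Y m) v) (f (Y m)))"
    by (subst linear_on_sum[OF vector_space_axioms subspace_V f]) (auto simp: linear_onD(3)[OF f])
  finally show ?thesis .
qed

lemma ip_sum_scale:
  assumes "u \<in> V" "\<And>i. i \<in> I \<Longrightarrow> f i \<in> V"
  shows "ip u (\<Sum>i\<in>I. smul (a i) (f i)) = (\<Sum>i\<in>I. a i * ip u (f i))"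
  using assms by (subst ip_sum) (auto simp: ip_scale)

lemma action_sum_scale:
  assumes "\<And>i. i \<in> I \<Longrightarrow> f i \<in> V"
  shows "\<rho> g (\<Sum>i\<in>I. smul (a i) (f i)) = (\<Sum>i\<in>I. smul (a i) (\<rho> g (f i)))"
  using assms by (subst action_sum) (auto simp: action_scale)

lemma eqI:
  assumes "u \<in> V" "v \<in> V" "\<And>m. m < d \<Longrightarrow> ip (Y m) u = ip (Y m) v"
  shows "u = v"
proof -
  have "(\<Sum>m<d. smul (ip (Y m) u) (Y m)) = (\<Sum>m<d. smul (ip (Y m) v) (Y m))"
    by (intro sum.cong) (simp_all add: assms(3))
  then show ?thesis
    by (simp only: expand[OF assms(1), symmetric] expand[OF assms(2), symmetric])
qed

lemma ip_sum_scale_Y: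
  assumes n: "n < d"
  shows "ip (Y n) (\<Sum>m<d. smul (a m) (Y m)) = a n"
proof -
  have "ip (Y n) (\<Sum>m<d. smul (a m) (Y m)) = (\<Sum>m<d. a m * ip (Y n) (Y m))"
    using n by (intro ip_sum_scale) auto
  also have "\<dots> = (\<Sum>m<d. if n = m then a m else 0)"
    using n by (intro sum.cong) (auto simp: ip_Y)
  finally show ?thesis using n by simp
qed

text \<open>Antilinearity in the first argument is derived from linearity in the second and
  conjugate symmetry.\<close>

lemma ip_conj_left:
  assumes "v \<in> V"
  shows "ip (\<Sum>m<d. smul (rcnj (a m)) (Y m)) v = (\<Sum>m<d. a m * ip (Y m) v)"
proof -
  have "ip (\<Sum>m<d. smul (rcnj (a m)) (Y m)) v = rcnj (ip v (\<Sum>m<d. smul (rcnj (a m)) (Y m)))"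
    using assms by (intro ip_commute sum_in) auto
  also have "\<dots> = rcnj (\<Sum>m<d. rcnj (a m) * ip v (Y m))"
    using assms by (subst ip_sum_scale) auto
  also have "\<dots> = (\<Sum>m<d. a m * ip (Y m) v)"
    unfolding rcnj_sum using assms by (intro sum.cong) (auto simp: rcnj_mult ip_commute[of "Y _" v])
  finally show ?thesis .
qed

lemma parseval: assumes "v \<in> V" shows "ip v v = of_real (\<Sum>m<d. (norm (ip (Y m) v))\<^sup>2)"
proof -
  have "ip v v = ip (\<Sum>m<d. smul (rcnj (rcnj (ip (Y m) v))) (Y m)) v"
    by (simp only: rcnj_rcnj expand[OF assms, symmetric])
  also have "\<dots> = of_real (\<Sum>m<d. (norm (ip (Y m) v))\<^sup>2)"
    unfolding ip_conj_left[OF assms] of_real_sum norm_power2_rc ..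
  finally show ?thesis .
qed

lemma norm_ip_Y_le: assumes "v \<in> V" "m < d" shows "norm (ip (Y m) v) \<le> rnorm R v"
proof -
  have "(norm (ip (Y m) v))\<^sup>2 \<le> (\<Sum>m<d. (norm (ip (Y m) v))\<^sup>2)"
    by (rule member_le_sum[of m "{..<d}" "\<lambda>m. (norm (ip (Y m) v))\<^sup>2"]) (simp_all add: assms(2))
  also have "\<dots> \<le> norm (of_real (\<Sum>m<d. (norm (ip (Y m) v))\<^sup>2) :: 'k)"
    unfolding norm_of_real by (rule abs_ge_self)
  also have "\<dots> = norm (ip v v)"
    by (simp only: parseval[OF assms(1)])
  finally show ?thesis
    unfolding rnorm_def by (rule real_le_rsqrt)
qed

text \<open>Continuity of the representation is stated in \<open>rnorm\<close>, since the ambient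
  type carries no topology. Each coordinate is bounded by \<open>rnorm\<close>, so differences of
  matrix elements tend to 0 as well.\<close>

lemma continuous_matrix_element:
  assumes "v \<in> V" "m < d"
  shows "continuous_on UNIV (\<lambda>g. ip (Y m) (\<rho> g v))"
  unfolding continuous_on_def
proof safe
  fix g
  have "((\<lambda>h. ip (Y m) (\<rho> h v) - ip (Y m) (\<rho> g v)) \<longlongrightarrow> 0) (at g)"
  proof (rule Lim_null_comparison[OF _ action_continuous[OF assms(1)]])
    show "\<forall>\<^sub>F h in at g. norm (ip (Y m) (\<rho> h v) - ip (Y m) (\<rho> g v)) \<le> rnorm R (\<rho> h v - \<rho> g v)"
      using assms norm_ip_Y_le by (simp flip: ip_diff)
  qed
  then show "((\<lambda>g. ip (Y m) (\<rho> g v)) \<longlongrightarrow> ip (Y m) (\<rho> g v)) (at g)"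
    by (simp add: LIM_zero_iff)
qed

end

section \<open>Schur's lemma\<close>

text \<open>Kernel and image are invariant subspaces, hence trivial or everything; the vector
  \<open>v\<close> rules out the full kernel and the zero image.\<close>

lemma schur:
  fixes smul :: "'k::rc_field \<Rightarrow> 'v::ab_group_add \<Rightarrow> 'v"
  assumes vs: "vector_space smul"
    and R: "irreducible_unitary_rep smul R" and S: "irreducible_unitary_rep smul S"
    and f: "linear_on smul smul (rspace R) (rspace S) f"
    and equiv: "\<And>g v. v \<in> rspace R \<Longrightarrow> f (raction R g v) = raction S g (f v)"
    and v: "v \<in> rspace R" "f v \<noteq> 0"
  shows "rep_isomorphic smul smul R S"
proof -
  interpret vector_space smul by fact
  have uR: "unitary_rep smul R" and uS: "unitary_rep smul S"
    using R S by (auto simp: irreducible_unitary_rep_def)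
  have aR: "raction R g u \<in> rspace R" if "u \<in> rspace R" for g u
    using uR that by (auto simp: unitary_rep_def linear_on_def)
  have sR: "subspace (rspace R)" and sS: "subspace (rspace S)"
    and lS: "\<And>g. linear_on smul smul (rspace S) (rspace S) (raction S g)"
    using uR uS by (auto simp: unitary_rep_def)
  let ?N = "{u \<in> rspace R. f u = 0}"
  have N: "subspace ?N" by (rule linear_on_kernel[OF vs sR f vs])
  have "\<forall>g. \<forall>u\<in>?N. raction R g u \<in> ?N"
    using aR equiv linear_on_0[OF vs sS lS] by auto
  then have "?N = {0} \<or> ?N = rspace R"
    using R N unfolding irreducible_unitary_rep_def by auto
  then have ker: "?N = {0}" using v by auto
  have "f ` rspace R = {0} \<or> f ` rspace R = rspace S"
  proof -
    have "\<forall>g. \<forall>u\<in>f ` rspace R. raction S g u \<in> f ` rspace R"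
      using aR equiv by (metis (no_types, lifting) imageE imageI)
    moreover have "subspace (f ` rspace R)" by (rule linear_on_image[OF vs sR f vs])
    moreover have "f ` rspace R \<subseteq> rspace S" using linear_onD(1)[OF f] by auto
    ultimately show ?thesis using S unfolding irreducible_unitary_rep_def by auto
  qed
  then have "f ` rspace R = rspace S" using v by auto
  moreover have "inj_on f (rspace R)"
  proof (rule inj_onI)
    fix u w assume *: "u \<in> rspace R" "w \<in> rspace R" "f u = f w"
    then have "u - w \<in> ?N" using linear_on_diff[OF vs sR f] subspace_diff[OF sR] by simp
    then show "u = w" using ker by simp
  qed
  ultimately show ?thesis
    unfolding rep_isomorphic_def bij_betw_def using f equiv by blast
qed

section \<open>Equivariant bilinear maps and Clebsch-Gordan decompositions\<close>

lemma sum_fun_apply: "(sum f A) x = (\<Sum>a\<in>A. f a x)"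
  by (induction A rule: infinite_finite_induct) simp_all

lemma fscale_apply [simp]: "fscale smul a f x = smul a (f x)"
  by (simp add: fscale_def)

locale clebsch_gordan_rep = vector_space smul
  for smul :: "'k::rc_field \<Rightarrow> 'v::ab_group_add \<Rightarrow> 'v" +
  fixes R :: "'j \<Rightarrow> ('g::topological_group_add, 'v, 'k) rep" and Y :: "'j \<Rightarrow> nat \<Rightarrow> 'v"
    and cgm :: "'j \<Rightarrow> 'j \<Rightarrow> 'j \<Rightarrow> nat"
    and CG :: "'j \<Rightarrow> 'j \<Rightarrow> (('v \<Rightarrow> 'v \<Rightarrow> 'k) \<Rightarrow> 'k) \<Rightarrow> ('j \<times> nat \<Rightarrow> 'v)"
  assumes irreps: "irrep_representatives smul R"
    and basis: "\<And>j. orthonormal_basis smul (R j) (Y j)"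
    and cg: "clebsch_gordan smul R cgm CG"
begin

lemma irrep: "irreducible_unitary_rep smul (R j)"
  and nonisomorphic: "rep_isomorphic smul smul (R i) (R j) \<Longrightarrow> i = j"
  using irreps unfolding irrep_representatives_def by blast+

sublocale rep: unirep smul "R j" "Y j" for j
  using irrep[of j] basis[of j] by unfold_locales (auto simp: irreducible_unitary_rep_def)

abbreviation V :: "'j \<Rightarrow> 'v set" where "V j \<equiv> rspace (R j)"
abbreviation \<rho> :: "'j \<Rightarrow> 'g \<Rightarrow> 'v \<Rightarrow> 'v" where "\<rho> j \<equiv> raction (R j)"
abbreviation ip :: "'j \<Rightarrow> 'v \<Rightarrow> 'v \<Rightarrow> 'k" where "ip j \<equiv> rinner (R j)"
abbreviation d :: "'j \<Rightarrow> nat" where "d j \<equiv> rdim smul (R j)"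

abbreviation T :: "'j \<Rightarrow> 'j \<Rightarrow> (('v \<Rightarrow> 'v \<Rightarrow> 'k) \<Rightarrow> 'k) set" where
  "T j l \<equiv> tensor_space smul (V j) (V l)"
abbreviation tens :: "'j \<Rightarrow> 'j \<Rightarrow> 'v \<Rightarrow> 'v \<Rightarrow> ('v \<Rightarrow> 'v \<Rightarrow> 'k) \<Rightarrow> 'k" where
  "tens j l \<equiv> tensor smul (V j) (V l)"
abbreviation tens_action :: "'j \<Rightarrow> 'j \<Rightarrow> 'g \<Rightarrow> (('v \<Rightarrow> 'v \<Rightarrow> 'k) \<Rightarrow> 'k) \<Rightarrow> ('v \<Rightarrow> 'v \<Rightarrow> 'k) \<Rightarrow> 'k" where
  "tens_action j l g \<equiv> tensor_map smul (V j) (V l) (\<rho> j g) (\<rho> l g)"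
abbreviation D :: "'j \<Rightarrow> 'j \<Rightarrow> ('j \<times> nat \<Rightarrow> 'v) set" where
  "D j l \<equiv> direct_sum {(J, s). s < cgm J j l} (\<lambda>(J, s). V J)"

definition cg_component :: "'j \<Rightarrow> 'j \<Rightarrow> 'j \<Rightarrow> nat \<Rightarrow> 'v \<Rightarrow> 'v \<Rightarrow> 'v" where
  "cg_component J j l s v w = CG j l (tens j l v w) (J, s)"

definition equivariant_bilinear :: "'j \<Rightarrow> 'j \<Rightarrow> 'j \<Rightarrow> ('v \<Rightarrow> 'v \<Rightarrow> 'v) \<Rightarrow> bool" where
  "equivariant_bilinear j l J \<beta> \<longleftrightarrow>
     (\<forall>v\<in>V j. linear_on smul smul (V l) (V J) (\<beta> v)) \<and>
     (\<forall>w\<in>V l. linear_on smul smul (V j) (V J) (\<lambda>v. \<beta> v w)) \<and>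
     (\<forall>g. \<forall>v\<in>V j. \<forall>w\<in>V l. \<beta> (\<rho> j g v) (\<rho> l g w) = \<rho> J g (\<beta> v w))"

lemma V_nontrivial: "V j \<noteq> {0}"
  using irrep[of j] by (simp add: irreducible_unitary_rep_def)

lemma schur_zero:
  assumes "linear_on smul smul (V i) (V j) f"
    and "\<And>g v. v \<in> V i \<Longrightarrow> f (\<rho> i g v) = \<rho> j g (f v)"
    and "i \<noteq> j" "v \<in> V i"
  shows "f v = 0"
  using schur[OF vector_space_axioms irrep irrep assms(1,2) assms(4)] nonisomorphic assms(3) by blast

lemma CG_linear: "linear_on (fscale (*)) (fscale smul) (T j l) (D j l) (CG j l)"
  and CG_bij: "bij_betw (CG j l) (T j l) (D j l)"
  and CG_equivariant: "t \<in> T j l \<Longrightarrow>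
    CG j l (tens_action j l g t) = (\<lambda>(J, s). \<rho> J g (CG j l t (J, s)))"
  using cg by (simp_all add: clebsch_gordan_def Let_def)

interpretation fk: vector_space "fscale ((*) :: 'k \<Rightarrow> 'k \<Rightarrow> 'k) :: 'k \<Rightarrow> ('a \<Rightarrow> 'k) \<Rightarrow> ('a \<Rightarrow> 'k)"
  by (rule vector_space_fscale[OF vector_space_times])

interpretation fs: vector_space "fscale smul :: 'k \<Rightarrow> ('a \<Rightarrow> 'v) \<Rightarrow> ('a \<Rightarrow> 'v)"
  by (rule vector_space_fscale[OF vector_space_axioms])

section \<open>Tensor products: induction over pure tensors and the diagonal action\<close>

lemma T_subspace: "fk.subspace (T j l)"
  by (simp add: tensor_space_def)

lemma tens_in_T: "v \<in> V j \<Longrightarrow> w \<in> V l \<Longrightarrow> tens j l v w \<in> T j l"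
  unfolding tensor_space_def by (rule fk.span_base) blast

text \<open>The step keeps \<open>t \<in> T j l\<close> at hand because \<open>CG j l\<close> is
  known to be linear on that subspace only.\<close>

lemma T_induct [consumes 1, case_names zero step]:
  assumes "t \<in> T j l" and "P 0"
    and "\<And>a v w t. v \<in> V j \<Longrightarrow> w \<in> V l \<Longrightarrow> t \<in> T j l \<Longrightarrow> P t \<Longrightarrow> P (fscale (*) a (tens j l v w) + t)"
  shows "P t"
proof -
  have "t \<in> T j l \<and> P t"
    using assms(1) unfolding tensor_space_def
  proof (induction rule: fk.span_induct_alt)
    case base
    show ?case by (rule conjI[OF fk.span_zero assms(2)])
  next
    case (step c x y)
    then obtain v w where "v \<in> V j" "w \<in> V l" "x = tens j l v w" by blast
    moreover from this have "x \<in> T j l" by (simp add: tens_in_T)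
    moreover have "y \<in> T j l" using step(2) unfolding tensor_space_def by (rule conjunct1)
    moreover have "P y" using step(2) by (rule conjunct2)
    ultimately have "fscale (*) c x + y \<in> T j l \<and> P (fscale (*) c x + y)"
      by (simp add: assms(3) fk.subspace_add[OF T_subspace] fk.subspace_scale[OF T_subspace])
    then show ?case unfolding tensor_space_def .
  qed
  then show ?thesis by simp
qed

lemma tens_action_linear:
  "tens_action j l g (fscale (*) a t + t') = fscale (*) a (tens_action j l g t) + tens_action j l g t'"
  by (simp add: tensor_map_def fun_eq_iff)

lemma tens_action_tens: "tens_action j l g (tens j l v w) = tens j l (\<rho> j g v) (\<rho> l g w)"
  by (rule tensor_map_tensor[OF rep.action_linear rep.action_linear])

lemma tens_action_0: "tens_action j l g 0 = 0"
  by (simp add: tensor_map_def fun_eq_iff)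

lemma tens_action_in_T: "t \<in> T j l \<Longrightarrow> tens_action j l g t \<in> T j l"
proof (induction rule: T_induct)
  case zero
  have "tens_action j l g 0 \<in> T j l"
    by (simp add: tens_action_0 fk.subspace_0[OF T_subspace])
  then show ?case .
next
  case (step a v w t)
  then have "tens_action j l g (fscale (*) a (tens j l v w) + t) \<in> T j l"
    by (simp add: tens_action_linear tens_action_tens fk.subspace_add[OF T_subspace]
        fk.subspace_scale[OF T_subspace] tens_in_T)
  then show ?case .
qed

lemma equivariant_bilinearD:
  assumes "equivariant_bilinear j l J \<beta>"
  shows "v \<in> V j \<Longrightarrow> linear_on smul smul (V l) (V J) (\<beta> v)"
    and "w \<in> V l \<Longrightarrow> linear_on smul smul (V j) (V J) (\<lambda>v. \<beta> v w)"
    and "v \<in> V j \<Longrightarrow> w \<in> V l \<Longrightarrow> \<beta> (\<rho> j g v) (\<rho> l g w) = \<rho> J g (\<beta> v w)"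
  using assms by (auto simp: equivariant_bilinear_def)

lemma equivariant_bilinear_in:
  "equivariant_bilinear j l J \<beta> \<Longrightarrow> v \<in> V j \<Longrightarrow> w \<in> V l \<Longrightarrow> \<beta> v w \<in> V J"
  by (rule linear_onD(1)[OF equivariant_bilinearD(1)])

lemma tens_linear_right: "v \<in> V j \<Longrightarrow> linear_on smul (fscale (*)) (V l) (T j l) (tens j l v)"
  unfolding linear_on_def using tens_in_T
  by (auto simp: tensor_def fun_eq_iff bilinear_form_on_def linear_on_def)

lemma tens_linear_left: "w \<in> V l \<Longrightarrow> linear_on smul (fscale (*)) (V j) (T j l) (\<lambda>v. tens j l v w)"
  unfolding linear_on_def using tens_in_T
  by (auto simp: tensor_def fun_eq_iff bilinear_form_on_def linear_on_def)

lemma CG_in: "t \<in> T j l \<Longrightarrow> CG j l t \<in> D j l"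
  by (rule linear_onD(1)[OF CG_linear])

lemma D_component: "x \<in> D j l \<Longrightarrow> s < cgm J j l \<Longrightarrow> x (J, s) \<in> V J"
  unfolding direct_sum_def by fastforce

lemma cg_component_equivariant_bilinear:
  assumes "s < cgm J j l"
  shows "equivariant_bilinear j l J (cg_component J j l s)"
proof -
  have "cg_component J j l s v w \<in> V J" if "v \<in> V j" "w \<in> V l" for v w
    unfolding cg_component_def by (rule D_component[OF CG_in[OF tens_in_T[OF that]] assms])
  moreover have "cg_component J j l s (\<rho> j g v) (\<rho> l g w) = \<rho> J g (cg_component J j l s v w)"
    if "v \<in> V j" "w \<in> V l" for v w g
    using CG_equivariant[OF tens_in_T[OF that], of g]
    by (simp add: cg_component_def tens_action_tens)
  ultimately show ?thesis
    unfolding equivariant_bilinear_def linear_on_def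
    by (simp add: cg_component_def tens_in_T linear_onD(2,3)[OF CG_linear]
        linear_onD(2,3)[OF tens_linear_right] linear_onD(2,3)[OF tens_linear_left])
qed

text \<open>
  Tensors are functionals on bilinear forms, so a vector-valued bilinear map is lifted by evaluating
  the tensor at its coordinate forms.
\<close>

definition tensor_lift :: "'j \<Rightarrow> ('v \<Rightarrow> 'v \<Rightarrow> 'v) \<Rightarrow> (('v \<Rightarrow> 'v \<Rightarrow> 'k) \<Rightarrow> 'k) \<Rightarrow> 'v" where
  "tensor_lift J \<beta> t = (\<Sum>M<d J. smul (t (\<lambda>v w. ip J (Y J M) (\<beta> v w))) (Y J M))"

lemma tensor_lift_in: "tensor_lift J \<beta> t \<in> V J"
  unfolding tensor_lift_def by (rule rep.sum_in) simp

lemma tensor_lift_add: "tensor_lift J \<beta> (t + t') = tensor_lift J \<beta> t + tensor_lift J \<beta> t'"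
  by (simp add: tensor_lift_def scale_left_distrib sum.distrib)

lemma tensor_lift_scale: "tensor_lift J \<beta> (fscale (*) a t) = smul a (tensor_lift J \<beta> t)"
  by (simp add: tensor_lift_def scale_sum_right)

lemma tensor_lift_0: "tensor_lift J \<beta> 0 = 0"
  by (simp add: tensor_lift_def)

lemma tensor_lift_tens:
  assumes "equivariant_bilinear j l J \<beta>" "v \<in> V j" "w \<in> V l"
  shows "tensor_lift J \<beta> (tens j l v w) = \<beta> v w"
proof -
  \<comment> \<open>\<open>tensor\<close> returns the default 0 on anything that is not a bilinear
    form, so the coordinate forms are checked before a pure tensor is evaluated at them.\<close>
  have "bilinear_form_on smul (V j) (V l) (\<lambda>v w. ip J (Y J M) (\<beta> v w))" if "M < d J" for M
    using that equivariant_bilinear_in[OF assms(1)]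
    by (simp add: bilinear_form_on_def linear_on_def rep.ip_add rep.ip_scale
        linear_onD(2,3)[OF equivariant_bilinearD(1)[OF assms(1)]]
        linear_onD(2,3)[OF equivariant_bilinearD(2)[OF assms(1)]])
  then have "tensor_lift J \<beta> (tens j l v w) = (\<Sum>M<d J. smul (ip J (Y J M) (\<beta> v w)) (Y J M))"
    unfolding tensor_lift_def by (intro sum.cong) (simp_all add: tensor_def)
  also have "\<dots> = \<beta> v w"
    by (rule rep.expand[symmetric, OF equivariant_bilinear_in[OF assms]])
  finally show ?thesis .
qed

lemma tensor_lift_equivariant:
  assumes \<beta>: "equivariant_bilinear j l J \<beta>" and "t \<in> T j l"
  shows "tensor_lift J \<beta> (tens_action j l g t) = \<rho> J g (tensor_lift J \<beta> t)"
  using assms(2)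
proof (induction rule: T_induct)
  case zero
  have "tensor_lift J \<beta> (tens_action j l g 0) = \<rho> J g (tensor_lift J \<beta> 0)"
    by (simp add: tens_action_0 tensor_lift_0)
  then show ?case .
next
  case (step a v w t)
  let ?u = "fscale (*) a (tens j l v w) + t"
  have "tensor_lift J \<beta> (tens_action j l g ?u) = \<rho> J g (tensor_lift J \<beta> ?u)"
    using step by (simp add: tens_action_linear tens_action_tens tensor_lift_add tensor_lift_scale
        tensor_lift_tens[OF \<beta>] tensor_lift_in rep.action_plus rep.action_scale
        equivariant_bilinearD(3)[OF \<beta>] equivariant_bilinear_in[OF \<beta>])
  then show ?case .
qed

section \<open>Equivariant bilinear maps as families of endomorphisms\<close>

lemma D_subspace: "fs.subspace (D j l)"
proof -
  have "finite {i. x i + y i \<noteq> 0}" if "finite {i. x i \<noteq> 0}" "finite {i. y i \<noteq> 0}"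
    for x y :: "'j \<times> nat \<Rightarrow> 'v"
    by (rule finite_subset[OF _ finite_UnI[OF that]]) auto
  moreover have "finite {i. smul c (x i) \<noteq> 0}" if "finite {i. x i \<noteq> 0}"
    for c and x :: "'j \<times> nat \<Rightarrow> 'v"
    by (rule finite_subset[OF _ that]) auto
  ultimately show ?thesis
    unfolding fs.subspace_def direct_sum_def by auto
qed

definition summand :: "'j \<times> nat \<Rightarrow> 'v \<Rightarrow> 'j \<times> nat \<Rightarrow> 'v" where
  "summand k v = (\<lambda>_. 0)(k := v)"

lemma summand_0 [simp]: "summand k 0 = 0"
  by (simp add: summand_def fun_eq_iff)

lemma summand_linear:
  assumes "s < cgm J j l"
  shows "linear_on smul (fscale smul) (V J) (D j l) (summand (J, s))"
proof -
  have "summand (J, s) v \<in> D j l" if "v \<in> V J" for v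
  proof -
    have "finite {i. summand (J, s) v i \<noteq> 0}"
      by (rule finite_subset[of _ "{(J, s)}"]) (auto simp: summand_def)
    then show ?thesis
      using that assms by (auto simp: direct_sum_def summand_def)
  qed
  then show ?thesis
    by (auto simp: linear_on_def summand_def fun_eq_iff)
qed

text \<open>Lifted to the tensor product and moved through the inverse of \<open>CG j l\<close>, the
  bilinear map becomes an intertwiner \<open>L\<close> from the direct sum to \<open>V J\<close>.
  Schur's lemma kills it on the copies of every \<open>V J'\<close> with
  \<open>J' \<noteq> J\<close>, and its restriction to the \<open>s\<close>-th copy of
  \<open>V J\<close> is \<open>c s\<close>.\<close>

lemma cg_expansion:
  assumes \<beta>: "equivariant_bilinear j l J \<beta>"
  obtains c where "\<And>s. s < cgm J j l \<Longrightarrow> c s \<in> End_G smul (R J)"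
    and "\<And>v w. v \<in> V j \<Longrightarrow> w \<in> V l \<Longrightarrow> \<beta> v w = (\<Sum>s<cgm J j l. c s (cg_component J j l s v w))"
proof -
  define L where "L x = tensor_lift J \<beta> (inv_into (T j l) (CG j l) x)" for x
  have inv: "inv_into (T j l) (CG j l) (CG j l t) = t" if "t \<in> T j l" for t
    using CG_bij that by (simp add: bij_betw_def)
  have inv': "\<exists>t\<in>T j l. x = CG j l t" if "x \<in> D j l" for x
    using CG_bij[of j l] that by (auto simp: bij_betw_def)
  have L_linear: "linear_on (fscale smul) smul (D j l) (V J) L"
    unfolding linear_on_def L_def
    using linear_onD[OF linear_on_inv_into[OF fk.vector_space_axioms T_subspace CG_linear CG_bij]]
    by (simp add: tensor_lift_in tensor_lift_add tensor_lift_scale)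
  have L_equiv: "L (\<lambda>(J, s). \<rho> J g (x (J, s))) = \<rho> J g (L x)" if x: "x \<in> D j l" for x g
  proof -
    obtain t where t: "t \<in> T j l" "x = CG j l t" using inv'[OF x] by blast
    then show ?thesis
      using CG_equivariant[OF t(1), of g, symmetric]
      by (simp add: L_def inv tens_action_in_T tensor_lift_equivariant[OF \<beta>])
  qed
  have Ls_linear: "linear_on smul smul (V J') (V J) (\<lambda>v. L (summand (J', s) v))"
    if "s < cgm J' j l" for J' s
    using linear_onD[OF summand_linear[OF that]] linear_onD[OF L_linear]
    by (simp add: linear_on_def)
  have Ls_equiv: "L (summand (J', s) (\<rho> J' g v)) = \<rho> J g (L (summand (J', s) v))"
    if "s < cgm J' j l" "v \<in> V J'" for J' s g v
  proof -
    \<comment> \<open>The action is linear, so the componentwise action keeps the zero entries of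
      the other components and preserves the summand.\<close>
    have "summand (J', s) (\<rho> J' g v) = (\<lambda>(J'', s'). \<rho> J'' g (summand (J', s) v (J'', s')))"
      by (auto simp: summand_def fun_eq_iff)
    then show ?thesis
      using L_equiv[OF linear_onD(1)[OF summand_linear]] that by simp
  qed
  define c where "c s v = (if v \<in> V J then L (summand (J, s) v) else 0)" for s v
  have "c s \<in> End_G smul (R J)" if "s < cgm J j l" for s
    using Ls_equiv[OF that] linear_onD[OF Ls_linear[OF that]]
    by (auto simp: End_G_def Hom_space_def c_def linear_on_def)
  moreover have "\<beta> v w = (\<Sum>s<cgm J j l. c s (cg_component J j l s v w))"
    if v: "v \<in> V j" and w: "w \<in> V l" for v w
  proof -
    define x where "x = CG j l (tens j l v w)"
    have x: "x \<in> D j l" unfolding x_def by (rule CG_in[OF tens_in_T[OF v w]])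
    \<comment> \<open>All indices \<open>(J, s)\<close> are added to the support of
      \<open>x\<close>, so that cutting the sum down to them below leaves the full range of
      \<open>s\<close>.\<close>
    define S where "S = {k. x k \<noteq> 0} \<union> Pair J ` {..<cgm J j l}"
    have S: "finite S" "S \<subseteq> {(J, s). s < cgm J j l}"
      using x by (auto simp: S_def direct_sum_def)
    have sx: "summand k (x k) \<in> D j l" if "k \<in> S" for k
      using that S(2) x linear_onD(1)[OF summand_linear] D_component by (cases k) auto
    have "x = (\<Sum>k\<in>S. summand k (x k))"
    proof
      fix i
      have "(\<Sum>k\<in>S. summand k (x k)) i = (\<Sum>k\<in>S. if i = k then x k else 0)"
        unfolding sum_fun_apply by (intro sum.cong) (auto simp: summand_def)
      also have "\<dots> = x i" using S(1) by (auto simp: S_def)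
      finally show "x i = (\<Sum>k\<in>S. summand k (x k)) i" by simp
    qed
    then have "L x = L (\<Sum>k\<in>S. summand k (x k))" by simp
    also have "\<dots> = (\<Sum>k\<in>S. L (summand k (x k)))"
      by (rule linear_on_sum[OF fs.vector_space_axioms D_subspace L_linear sx])
    also have "\<dots> = (\<Sum>k\<in>Pair J ` {..<cgm J j l}. L (summand k (x k)))"
    proof (rule sum.mono_neutral_right[OF S(1)])
      show "\<forall>k\<in>S - Pair J ` {..<cgm J j l}. L (summand k (x k)) = 0"
      proof
        fix k assume k: "k \<in> S - Pair J ` {..<cgm J j l}"
        obtain J' s where k': "k = (J', s)" by fastforce
        then have s: "s < cgm J' j l" "J' \<noteq> J" using k S(2) by auto
        show "L (summand k (x k)) = 0"
          unfolding k' by (rule schur_zero[OF Ls_linear Ls_equiv]) (use s D_component[OF x] in auto)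
      qed
    qed (auto simp: S_def)
    also have "\<dots> = (\<Sum>s<cgm J j l. L (summand (J, s) (x (J, s))))"
      by (simp add: sum.reindex inj_on_def)
    also have "\<dots> = (\<Sum>s<cgm J j l. c s (cg_component J j l s v w))"
      using D_component[OF x] by (intro sum.cong) (auto simp: c_def cg_component_def x_def)
    also have "L x = \<beta> v w"
      by (simp add: L_def x_def inv tens_in_T v w tensor_lift_tens[OF \<beta>])
    finally show ?thesis .
  qed
  ultimately show thesis by (rule that)
qed

lemma End_G_linear: "c \<in> End_G smul (R J) \<Longrightarrow> linear_on smul smul (V J) (V J) c"
  and End_G_outside: "c \<in> End_G smul (R J) \<Longrightarrow> v \<notin> V J \<Longrightarrow> c v = 0"
  and End_G_equivariant: "c \<in> End_G smul (R J) \<Longrightarrow> v \<in> V J \<Longrightarrow> c (\<rho> J g v) = \<rho> J g (c v)"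
  by (auto simp: End_G_def Hom_space_def)

lemmas End_G_in = linear_onD(1)[OF End_G_linear]
  and End_G_add = linear_onD(2)[OF End_G_linear]
  and End_G_scale = linear_onD(3)[OF End_G_linear]
  and End_G_0 = linear_on_0[OF vector_space_axioms rep.subspace_V End_G_linear]

text \<open>The vanishing passes from pure tensors to all of \<open>T j l\<close> by linearity.
  Since \<open>CG j l\<close> is onto, some tensor has an image supported in the single component
  \<open>(J, s)\<close>, and it isolates \<open>c s\<close>.\<close>

lemma cg_expansion_unique:
  assumes c: "\<And>s. s < cgm J j l \<Longrightarrow> c s \<in> End_G smul (R J)"
    and zero: "\<And>v w. v \<in> V j \<Longrightarrow> w \<in> V l \<Longrightarrow> (\<Sum>s<cgm J j l. c s (cg_component J j l s v w)) = 0"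
    and s: "s < cgm J j l"
  shows "c s = 0"
proof -
  have T: "(\<Sum>s<cgm J j l. c s (CG j l t (J, s))) = 0" if "t \<in> T j l" for t
    using that
  proof (induction rule: T_induct)
    case zero
    have "(\<Sum>s<cgm J j l. c s (CG j l 0 (J, s))) = 0"
      by (intro sum.neutral)
         (simp add: linear_on_0[OF fk.vector_space_axioms T_subspace CG_linear] End_G_0[OF c])
    then show ?case .
  next
    case (step a v w t)
    have 1: "CG j l (fscale (*) a (tens j l v w) + t) = fscale smul a (CG j l (tens j l v w)) + CG j l t"
      using step by (simp add: linear_onD(2,3)[OF CG_linear] tens_in_T fk.subspace_scale[OF T_subspace])
    have "c s (CG j l (fscale (*) a (tens j l v w) + t) (J, s))
        = smul a (c s (cg_component J j l s v w)) + c s (CG j l t (J, s))" if "s < cgm J j l" for s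
      using that step D_component[OF CG_in[OF tens_in_T[of v j w l]] that]
        D_component[OF CG_in[OF \<open>t \<in> T j l\<close>] that]
      by (simp add: 1 End_G_add[OF c] End_G_scale[OF c] cg_component_def)
    then have "(\<Sum>s<cgm J j l. c s (CG j l (fscale (*) a (tens j l v w) + t) (J, s)))
       = smul a (\<Sum>s<cgm J j l. c s (cg_component J j l s v w)) + (\<Sum>s<cgm J j l. c s (CG j l t (J, s)))"
      by (simp add: scale_sum_right sum.distrib)
    then have "(\<Sum>s<cgm J j l. c s (CG j l (fscale (*) a (tens j l v w) + t) (J, s))) = 0"
      using step zero by simp
    then show ?case .
  qed
  show ?thesis
  proof
    fix v
    show "c s v = 0 v"
    proof (cases "v \<in> V J")
      case True
      obtain t where t: "t \<in> T j l" "summand (J, s) v = CG j l t"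
        using linear_onD(1)[OF summand_linear[OF s] True] CG_bij[of j l] by (auto simp: bij_betw_def)
      have "0 = (\<Sum>s'<cgm J j l. c s' (summand (J, s) v (J, s')))"
        using T[OF t(1)] by (simp add: t(2))
      also have "\<dots> = (\<Sum>s'<cgm J j l. if s = s' then c s v else 0)"
        using End_G_0[OF c] by (intro sum.cong) (auto simp: summand_def)
      also have "\<dots> = c s v" using s by simp
      finally show ?thesis by simp
    qed (use End_G_outside[OF c[OF s]] in simp)
  qed
qed

text \<open>
  The \<open>u \<in> V\<^sub>i\<close> for which \<open>\<beta>\<^sub>i(u, -)\<close> is a combination of the other \<open>\<beta>\<^sub>j(-, -)\<close> form a
  subrepresentation. It is not \<open>V\<^sub>i\<close>: the arguments in the combination, unique by induction, would be
  intertwiners into non-isomorphic irreducibles, hence zero.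
\<close>

lemma independent_intertwiners:
  assumes "finite F"
    and "\<And>j. j \<in> F \<Longrightarrow> equivariant_bilinear j l J (\<beta> j)"
    and "\<And>j. j \<in> F \<Longrightarrow> \<exists>v\<in>V j. \<exists>w\<in>V l. \<beta> j v w \<noteq> 0"
    and "\<And>j. j \<in> F \<Longrightarrow> v j \<in> V j"
    and "\<And>w. w \<in> V l \<Longrightarrow> (\<Sum>j\<in>F. \<beta> j (v j) w) = 0"
    and "j \<in> F"
  shows "v j = 0"
  using assms
proof (induction F arbitrary: v j rule: finite_induct)
  case (insert i F)
  have eb: "equivariant_bilinear j l J (\<beta> j)" if "j \<in> insert i F" for j
    using insert.prems(1) that by blast
  have add: "\<beta> j (u + u') w = \<beta> j u w + \<beta> j u' w"
    and scl: "\<beta> j (smul a u) w = smul a (\<beta> j u w)"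
    and diff: "\<beta> j (u - u') w = \<beta> j u w - \<beta> j u' w"
    if "j \<in> insert i F" "u \<in> V j" "u' \<in> V j" "w \<in> V l" for j a u u' w
  proof -
    note lin = equivariant_bilinearD(2)[OF eb[OF that(1)] that(4)]
    show "\<beta> j (u + u') w = \<beta> j u w + \<beta> j u' w" "\<beta> j (smul a u) w = smul a (\<beta> j u w)"
      using linear_onD(2,3)[OF lin] that by auto
    show "\<beta> j (u - u') w = \<beta> j u w - \<beta> j u' w"
      using linear_on_diff[OF vector_space_axioms rep.subspace_V lin] that by auto
  qed
  have zero: "\<beta> j 0 w = 0" if "j \<in> insert i F" "w \<in> V l" for j w
    using linear_on_0[OF vector_space_axioms rep.subspace_V equivariant_bilinearD(2)[OF eb]] that
    by auto
  \<comment> \<open>Uniqueness of the arguments is the induction hypothesis for their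
    differences.\<close>
  have uniq: "a j = b j"
    if "\<And>j. j \<in> F \<Longrightarrow> a j \<in> V j" "\<And>j. j \<in> F \<Longrightarrow> b j \<in> V j"
      "\<And>w. w \<in> V l \<Longrightarrow> (\<Sum>j\<in>F. \<beta> j (a j) w) = (\<Sum>j\<in>F. \<beta> j (b j) w)" "j \<in> F" for a b j
  proof -
    have "a j - b j = 0"
    proof (rule insert.IH[of "\<lambda>j. a j - b j"])
      fix w assume w: "w \<in> V l"
      have "(\<Sum>j\<in>F. \<beta> j (a j - b j) w) = (\<Sum>j\<in>F. \<beta> j (a j) w - \<beta> j (b j) w)"
        using that(1,2) w by (intro sum.cong) (simp_all add: diff)
      then show "(\<Sum>j\<in>F. \<beta> j (a j - b j) w) = 0"
        using that(3)[OF w] by (simp add: sum_subtractf)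
    qed (use that insert.prems in auto)
    then show ?thesis by simp
  qed
  define rel where "rel u a \<longleftrightarrow> (\<forall>j\<in>F. a j \<in> V j) \<and> (\<forall>w\<in>V l. \<beta> i u w = (\<Sum>j\<in>F. \<beta> j (a j) w))" for u a
  have rel_add: "rel (u + u') (\<lambda>j. a j + a' j)" if "rel u a" "rel u' a'" "u \<in> V i" "u' \<in> V i" for u u' a a'
    unfolding rel_def
  proof (intro conjI ballI)
    fix w assume w: "w \<in> V l"
    have "(\<Sum>j\<in>F. \<beta> j (a j + a' j) w) = (\<Sum>j\<in>F. \<beta> j (a j) w + \<beta> j (a' j) w)"
      using that w by (intro sum.cong) (auto simp: add rel_def)
    then show "\<beta> i (u + u') w = (\<Sum>j\<in>F. \<beta> j (a j + a' j) w)"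
      using that w by (simp add: add rel_def sum.distrib)
  qed (use that in \<open>auto simp: rel_def\<close>)
  have rel_scale: "rel (smul c u) (\<lambda>j. smul c (a j))" if "rel u a" "u \<in> V i" for u a c
    unfolding rel_def
  proof (intro conjI ballI)
    fix w assume w: "w \<in> V l"
    have "(\<Sum>j\<in>F. \<beta> j (smul c (a j)) w) = (\<Sum>j\<in>F. smul c (\<beta> j (a j) w))"
      using that w by (intro sum.cong) (auto simp: scl rel_def)
    then show "\<beta> i (smul c u) w = (\<Sum>j\<in>F. \<beta> j (smul c (a j)) w)"
      using that w by (simp add: scl rel_def flip: scale_sum_right)
  qed (use that in \<open>auto simp: rel_def\<close>)
  have rel_action: "rel (\<rho> i g u) (\<lambda>j. \<rho> j g (a j))" if "rel u a" "u \<in> V i" for u a g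
    unfolding rel_def
  proof (intro conjI ballI)
    fix w assume w: "w \<in> V l"
    \<comment> \<open>The vector \<open>w\<close> is pulled back by \<open>g\<close>, so that
      equivariance can be applied to both arguments at once.\<close>
    define w' where "w' = \<rho> l (- g) w"
    have w': "w' \<in> V l" "w = \<rho> l g w'" using w by (auto simp: w'_def)
    have "\<beta> i (\<rho> i g u) w = \<rho> J g (\<beta> i u w')"
      using that w' by (simp add: equivariant_bilinearD(3)[OF eb])
    also have "\<dots> = \<rho> J g (\<Sum>j\<in>F. \<beta> j (a j) w')"
      using that w' by (simp add: rel_def)
    also have "\<dots> = (\<Sum>j\<in>F. \<rho> J g (\<beta> j (a j) w'))"
      using that w' by (intro rep.action_sum equivariant_bilinear_in[OF eb]) (auto simp: rel_def)
    also have "\<dots> = (\<Sum>j\<in>F. \<beta> j (\<rho> j g (a j)) w)"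
      using that w' by (intro sum.cong) (auto simp: equivariant_bilinearD(3)[OF eb] rel_def)
    finally show "\<beta> i (\<rho> i g u) w = (\<Sum>j\<in>F. \<beta> j (\<rho> j g (a j)) w)" .
  qed (use that in \<open>auto simp: rel_def\<close>)
  have rel_uniq: "a j = b j" if "rel u a" "rel u b" "j \<in> F" for u a b j
    by (rule uniq[OF _ _ _ that(3)]) (use that in \<open>auto simp: rel_def\<close>)
  define U where "U = {u \<in> V i. \<exists>a. rel u a}"
  have "rel 0 (\<lambda>_. 0)"
    using zero by (simp add: rel_def)
  then have "subspace U"
    unfolding subspace_def U_def using rel_add rel_scale by auto blast+
  moreover have "\<forall>g. \<forall>u\<in>U. \<rho> i g u \<in> U"
    unfolding U_def using rel_action by auto
  moreover have "U \<subseteq> V i" by (auto simp: U_def)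
  ultimately have "U = {0} \<or> U = V i"
    using irrep[of i] unfolding irreducible_unitary_rep_def by blast
  moreover have "U \<noteq> V i"
  proof
    assume "U = V i"
    then have "\<forall>u\<in>V i. \<exists>a. rel u a" by (auto simp: U_def)
    then obtain a where a: "\<And>u. u \<in> V i \<Longrightarrow> rel u (a u)" by metis
    have "a u j = 0" if j: "j \<in> F" and u: "u \<in> V i" for u j
    proof (rule schur_zero[of i j "\<lambda>u. a u j"])
      \<comment> \<open>The function \<open>a\<close> comes from an arbitrary choice. Its linearity
        and equivariance follow from uniqueness, since both sides of each equation are arguments of
        a combination for the same vector.\<close>
      show "linear_on smul smul (V i) (V j) (\<lambda>u. a u j)"
        unfolding linear_on_def
      proof (intro conjI ballI allI)
        fix u u' c assume u: "u \<in> V i"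
        show "a u j \<in> V j" using a[OF u] j by (auto simp: rel_def)
        show "a (smul c u) j = smul c (a u j)"
          by (rule rel_uniq[OF a rel_scale[OF a] j]) (use u in auto)
        assume u': "u' \<in> V i"
        show "a (u + u') j = a u j + a u' j"
          by (rule rel_uniq[OF a rel_add[OF a a] j]) (use u u' in auto)
      qed
      show "a (\<rho> i g u) j = \<rho> j g (a u j)" if "u \<in> V i" for g u
        by (rule rel_uniq[OF a rel_action[OF a] j]) (use that in auto)
    qed (use insert.hyps(2) j u in auto)
    moreover obtain u w where "u \<in> V i" "w \<in> V l" "\<beta> i u w \<noteq> 0"
      using insert.prems(2)[of i] by auto
    ultimately show False
      using a[of u] zero by (auto simp: rel_def)
  qed
  ultimately have U: "U = {0}" by blast
  have vi: "v i = 0"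
  proof -
    \<comment> \<open>Solving the given relation for its term at \<open>i\<close> puts
      \<open>v i\<close> into \<open>U\<close>. Once this term is gone, the induction hypothesis
      applies to the rest.\<close>
    have "rel (v i) (\<lambda>j. 0 - v j)"
      unfolding rel_def
    proof (intro conjI ballI)
      fix w assume w: "w \<in> V l"
      have "(\<Sum>j\<in>F. \<beta> j (0 - v j) w) = (\<Sum>j\<in>F. - \<beta> j (v j) w)"
        using w insert.prems(3) diff[of _ 0 "v _" w] zero[of _ w] by (intro sum.cong) auto
      then have *: "(\<Sum>j\<in>F. \<beta> j (0 - v j) w) = - (\<Sum>j\<in>F. \<beta> j (v j) w)"
        by (simp only: sum_negf)
      show "\<beta> i (v i) w = (\<Sum>j\<in>F. \<beta> j (0 - v j) w)"
        unfolding * using insert.prems(4)[OF w] insert.hyps by (simp add: eq_neg_iff_add_eq_0)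
    next
      show "0 - v j \<in> V j" if "j \<in> F" for j
        using that insert.prems(3) by (intro rep.diff_in) auto
    qed
    then have "v i \<in> U" using insert.prems(3)[of i] by (auto simp: U_def)
    then show ?thesis using U by simp
  qed
  show ?case
  proof (cases "j = i")
    case False
    show ?thesis
    proof (rule insert.IH)
      show "(\<Sum>j\<in>F. \<beta> j (v j) w) = 0" if "w \<in> V l" for w
        using insert.prems(4)[OF that] insert.hyps vi zero[of i w] that by simp
    qed (use insert.prems False in auto)
  qed (simp add: vi)
qed simp

section \<open>Finiteness of the set of contributing indices j\<close>

lemma cg_component_nonzero:
  assumes "cgm J j l \<noteq> 0"
  shows "\<exists>v\<in>V j. \<exists>w\<in>V l. cg_component J j l 0 v w \<noteq> 0"
proof (rule ccontr)
  assume *: "\<not> ?thesis"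
  \<comment> \<open>The identity on copy 0 and zero on the other copies: if component 0 vanished,
    uniqueness would make the identity of \<open>V J\<close> zero.\<close>
  define c where "c s = (\<lambda>v. if s = (0::nat) \<and> v \<in> V J then v else 0)" for s
  have "c 0 = 0"
  proof (rule cg_expansion_unique[where c = c])
    show "c s \<in> End_G smul (R J)" for s
      by (auto simp: End_G_def Hom_space_def linear_on_def c_def)
    show "(\<Sum>s<cgm J j l. c s (cg_component J j l s v w)) = 0" if "v \<in> V j" "w \<in> V l" for v w
      using * that by (intro sum.neutral) (auto simp: c_def)
  qed (use assms in simp)
  then have "c 0 v = 0" for v by simp
  then have "v = 0" if "v \<in> V J" for v
    using that unfolding c_def by metis
  then show False using V_nontrivial[of J] rep.zero_in[of J] by blast
qed

text \<open>For each \<open>j\<close> a nonzero \<open>v j\<close> is fixed, and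
  \<open>\<phi> j\<close> is the matrix of the linear map \<open>cg_component J j l 0 (v j)\<close>
  from \<open>V l\<close> to \<open>V J\<close>. For the \<open>j\<close> of positive multiplicity
  these matrices are independent, and all of them lie in the span of \<open>d J * d l\<close> matrix
  units.\<close>

lemma finite_multiplicities: "finite {j. cgm J j l \<noteq> 0}"
proof -
  let ?F = "{j. cgm J j l \<noteq> 0}"
  let ?\<beta> = "\<lambda>j. cg_component J j l 0"
  have eb: "equivariant_bilinear j l J (?\<beta> j)" if "j \<in> ?F" for j
    using that by (intro cg_component_equivariant_bilinear) simp
  have "\<exists>v. v \<in> V j \<and> v \<noteq> 0" for j
    using V_nontrivial[of j] rep.zero_in[of j] by blast
  then obtain v where v: "\<And>j. v j \<in> V j" "\<And>j. v j \<noteq> 0" by metis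
  let ?I = "{..<d J} \<times> {..<d l}"
  define \<phi> where "\<phi> j = (\<lambda>(M, n). if M < d J \<and> n < d l then ip J (Y J M) (?\<beta> j (v j) (Y l n)) else 0)" for j
  have indep: "a j = 0" if F: "finite F" "F \<subseteq> ?F" and sum: "(\<Sum>j\<in>F. fscale (*) (a j) (\<phi> j)) = 0"
    and j: "j \<in> F" for F a j
  proof -
    \<comment> \<open>Each scalar is absorbed into the first argument of its bilinear map, which
      turns a linear relation among matrices into the kind of relation that
      \<open>independent_intertwiners\<close> excludes.\<close>
    have "smul (a j) (v j) = 0"
    proof (rule independent_intertwiners[of F l J ?\<beta> "\<lambda>j. smul (a j) (v j)"])
      let ?B = "\<lambda>w. (\<Sum>j\<in>F. smul (a j) (?\<beta> j (v j) w))"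
      have eq: "(\<Sum>j\<in>F. ?\<beta> j (smul (a j) (v j)) w) = ?B w" if "w \<in> V l" for w
        using that F v by (intro sum.cong refl linear_onD(3)[OF equivariant_bilinearD(2)[OF eb]]) auto
      have lin: "linear_on smul smul (V l) (V J) (?\<beta> j (v j))" if "j \<in> F" for j
        by (rule equivariant_bilinearD(1)[OF eb]) (use that F v in auto)
      have linB: "linear_on smul smul (V l) (V J) ?B"
        using linear_onD[OF lin]
        by (simp add: linear_on_def rep.sum_in scale_right_distrib sum.distrib scale_sum_right
            scale_left_commute mult.commute)
      have B0: "?B (Y l n) = 0" if n: "n < d l" for n
      proof (rule rep.eqI)
        fix M assume M: "M < d J"
        have "ip J (Y J M) (?B (Y l n)) = (\<Sum>j\<in>F. a j * ip J (Y J M) (?\<beta> j (v j) (Y l n)))"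
          using M n linear_onD(1)[OF lin] by (intro rep.ip_sum_scale) auto
        also have "\<dots> = (\<Sum>j\<in>F. fscale (*) (a j) (\<phi> j)) (M, n)"
          using M n by (simp add: sum_fun_apply \<phi>_def)
        finally show "ip J (Y J M) (?B (Y l n)) = ip J (Y J M) 0"
          using M by (simp add: sum rep.ip_zero)
      qed (use n linear_onD(1)[OF linB] in auto)
      fix w assume w: "w \<in> V l"
      have "?B w = 0"
        using rep.linear_expand[OF linB w] B0 by simp
      then show "(\<Sum>j\<in>F. ?\<beta> j (smul (a j) (v j)) w) = 0" using eq[OF w] by simp
    next
      show "\<exists>v\<in>V j. \<exists>w\<in>V l. ?\<beta> j v w \<noteq> 0" if "j \<in> F" for j
        using that F by (intro cg_component_nonzero) auto
    qed (use F v j eb in auto)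
    then show ?thesis using v by simp
  qed
  \<comment> \<open>The dimension bound concerns the set of matrices; injectivity carries its
    finiteness back to the indices. Two equal matrices would satisfy the relation with coefficients
    1 and -1.\<close>
  have inj: "inj_on \<phi> ?F"
  proof (rule inj_onI, rule ccontr)
    fix j j' assume *: "j \<in> ?F" "j' \<in> ?F" "\<phi> j = \<phi> j'" "j \<noteq> j'"
    have "(1::'k) = 0"
      using indep[of "{j, j'}" "\<lambda>i. if i = j then 1 else - 1" j] *
      by (auto simp: fun_eq_iff)
    then show False by simp
  qed
  have "fk.independent (\<phi> ` ?F)"
    unfolding fk.independent_explicit_finite_subsets
  proof (intro allI impI ballI)
    fix S u x assume S: "S \<subseteq> \<phi> ` ?F" "finite S" "(\<Sum>v\<in>S. fscale (*) (u v) v) = 0" "x \<in> S"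
    obtain F where F: "F \<subseteq> ?F" "finite F" "S = \<phi> ` F"
      using finite_subset_image[OF S(2,1)] by blast
    have "inj_on \<phi> F" by (rule inj_on_subset[OF inj F(1)])
    then have "(\<Sum>j\<in>F. fscale (*) (u (\<phi> j)) (\<phi> j)) = 0"
      using S(3) F by (simp add: sum.reindex)
    then show "u x = 0" using indep[OF F(2,1), of "\<lambda>j. u (\<phi> j)"] S(4) F(3) by auto
  qed
  moreover define \<delta> where "\<delta> k = ((\<lambda>_. 0)(k := 1) :: nat \<times> nat \<Rightarrow> 'k)" for k
  have "\<phi> ` ?F \<subseteq> fk.span (\<delta> ` ?I)"
  proof safe
    fix j
    have "\<phi> j = (\<Sum>k\<in>?I. fscale (*) (\<phi> j k) (\<delta> k))"
    proof
      fix i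
      have "(\<Sum>k\<in>?I. fscale (*) (\<phi> j k) (\<delta> k)) i = (\<Sum>k\<in>?I. if i = k then \<phi> j k else 0)"
        unfolding sum_fun_apply by (intro sum.cong) (auto simp: \<delta>_def)
      also have "\<dots> = \<phi> j i" by (auto simp: \<phi>_def split: prod.splits)
      finally show "\<phi> j i = (\<Sum>k\<in>?I. fscale (*) (\<phi> j k) (\<delta> k)) i" by simp
    qed
    also have "\<dots> \<in> fk.span (\<delta> ` ?I)"
      by (intro fk.span_sum fk.span_scale fk.span_base) auto
    finally show "\<phi> j \<in> fk.span (\<delta> ` ?I)" .
  qed
  ultimately have "finite (\<phi> ` ?F)"
    using fk.independent_span_bound[of "\<delta> ` ?I"] by auto
  then show ?thesis by (rule finite_imageD[OF _ inj])
qed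

end

section \<open>Steerable kernels\<close>

text \<open>This is what remains of a finite harmonic expansion once orthonormality has turned its
  integrals into Kronecker deltas; the index \<open>j\<close> may fall outside
  \<open>F\<close>.\<close>

lemma sum_triple_delta:
  fixes a b :: "'j \<Rightarrow> nat"
  assumes "finite F"
  shows "(\<Sum>j'\<in>F. \<Sum>i'<a j'. \<Sum>m'<b j'. if (j', i', m') = (j, i, m) then f j' i' m' else 0)
    = (if j \<in> F \<and> i < a j \<and> m < b j then f j i m else (0::'k::comm_monoid_add))"
proof -
  let ?S = "Sigma F (\<lambda>j'. {..<a j'} \<times> {..<b j'})"
  have S: "finite ?S" using assms by (intro finite_SigmaI finite_cartesian_product) auto
  have "(\<Sum>j'\<in>F. \<Sum>i'<a j'. \<Sum>m'<b j'. if (j', i', m') = (j, i, m) then f j' i' m' else 0)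
      = (\<Sum>(j', i', m')\<in>?S. if (j', i', m') = (j, i, m) then f j' i' m' else 0)"
    using assms by (simp add: sum.Sigma)
  also have "\<dots> = (\<Sum>q\<in>?S. if (j, i, m) = q then f j i m else 0)"
    by (intro sum.cong) (auto split: if_splits)
  also have "\<dots> = (if j \<in> F \<and> i < a j \<and> m < b j then f j i m else 0)"
    using S by simp
  finally show ?thesis .
qed

locale harmonic_setting = clebsch_gordan_rep smul R Y cgm CG
  for smul :: "'k::rc_field \<Rightarrow> 'v::ab_group_add \<Rightarrow> 'v"
    and R :: "'j \<Rightarrow> ('g::topological_group_add, 'v, 'k) rep" and Y :: "'j \<Rightarrow> nat \<Rightarrow> 'v"
    and cgm :: "'j \<Rightarrow> 'j \<Rightarrow> 'j \<Rightarrow> nat"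
    and CG :: "'j \<Rightarrow> 'j \<Rightarrow> (('v \<Rightarrow> 'v \<Rightarrow> 'k) \<Rightarrow> 'k) \<Rightarrow> ('j \<times> nat \<Rightarrow> 'v)" +
  fixes act :: "'g \<Rightarrow> 'x::t2_space \<Rightarrow> 'x" and \<mu> :: "'x measure" and mh :: "'j \<Rightarrow> nat"
    and H :: "'j \<Rightarrow> nat \<Rightarrow> nat \<Rightarrow> 'x \<Rightarrow> 'k"
  assumes compact_group: "compact (UNIV :: 'g set)"
    and homogeneous: "homogeneous_space act"
    and invariant: "invariant_measure act \<mu>"
    and harmonic: "harmonic_basis smul act \<mu> R Y mh H"
begin

section \<open>Topology and invariant integration on the homogeneous space\<close>

lemma act_continuous: "continuous_on UNIV (\<lambda>(g, x). act g x)"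
  and act_transitive: "\<exists>g. act g x = y"
  using homogeneous by (simp_all add: homogeneous_space_def)

lemma orbit_continuous: "continuous_on UNIV (\<lambda>g. act g x)"
  and translation_continuous: "continuous_on UNIV (act g)"
proof -
  have "continuous_on UNIV ((\<lambda>(g, x). act g x) \<circ> (\<lambda>g. (g, x)))"
    by (intro continuous_on_compose continuous_intros continuous_on_subset[OF act_continuous]) auto
  then show "continuous_on UNIV (\<lambda>g. act g x)" by (simp add: o_def)
  have "continuous_on UNIV ((\<lambda>(g, x). act g x) \<circ> (\<lambda>x. (g, x)))"
    by (intro continuous_on_compose continuous_intros continuous_on_subset[OF act_continuous]) auto
  then show "continuous_on UNIV (act g)" by (simp add: o_def)
qed

lemma sets_\<mu> [measurable_cong]: "sets \<mu> = sets borel"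
  and emeasure_UNIV: "emeasure \<mu> UNIV = 1"
  and distr_act: "distr \<mu> borel (act g) = \<mu>"
  using invariant by (simp_all add: invariant_measure_def)

lemma space_\<mu> [simp]: "space \<mu> = UNIV"
  using sets_eq_imp_space_eq[OF sets_\<mu>] by simp

sublocale finite_measure \<mu>
  by (rule finite_measureI) (simp add: emeasure_UNIV)

lemma continuous_measurable:
  "continuous_on UNIV f \<Longrightarrow> (f :: 'x \<Rightarrow> 'b::topological_space) \<in> borel_measurable \<mu>"
  by (simp add: measurable_cong_sets[OF sets_\<mu> refl] borel_measurable_continuous_onI)

lemma integral_act:
  assumes "continuous_on UNIV (f :: 'x \<Rightarrow> 'k)"
  shows "(LINT x|\<mu>. f (act g x)) = (LINT x|\<mu>. f x)"
proof -
  have "integral\<^sup>L (distr \<mu> borel (act g)) f = (LINT x|\<mu>. f (act g x))"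
    by (intro integral_distr continuous_measurable translation_continuous
        borel_measurable_continuous_onI assms)
  then show ?thesis by (simp add: distr_act)
qed

text \<open>The orbit map is closed because the group is compact and the space is Hausdorff.\<close>

lemma continuous_on_orbit:
  fixes f :: "'x \<Rightarrow> 'k"
  assumes "continuous_on UNIV (\<lambda>g. f (act g x))"
  shows "continuous_on UNIV f"
proof -
  have "closed (f -` C)" if "closed C" for C
  proof -
    let ?A = "(\<lambda>g. f (act g x)) -` C"
    have "closed ?A"
      using assms that by (simp add: continuous_on_closed_vimage)
    then have "compact ?A"
      using compact_group closed_Int_compact[of ?A UNIV] by simp
    then have "compact ((\<lambda>g. act g x) ` ?A)"
      by (intro compact_continuous_image continuous_on_subset[OF orbit_continuous]) auto
    moreover have "(\<lambda>g. act g x) ` ?A = f -` C"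
    proof (intro equalityI subsetI)
      fix y assume y: "y \<in> f -` C"
      obtain g where "y = act g x" using act_transitive by metis
      then show "y \<in> (\<lambda>g. act g x) ` ?A" using y by blast
    qed auto
    ultimately show ?thesis by (simp add: compact_imp_closed)
  qed
  then show ?thesis by (simp add: continuous_on_closed_vimage)
qed

lemma compact_space: "compact (UNIV :: 'x set)"
proof -
  have "compact (range (\<lambda>g. act g undefined))"
    by (intro compact_continuous_image orbit_continuous compact_group)
  also have "range (\<lambda>g. act g undefined) = UNIV"
    using act_transitive[of undefined] by (metis surj_def)
  finally show ?thesis .
qed

lemma continuous_integrable:
  fixes f :: "'x \<Rightarrow> 'b::{banach, second_countable_topology}"
  assumes "continuous_on UNIV f"
  shows "integrable \<mu> f"
proof -
  obtain B where "\<forall>y\<in>range f. norm y \<le> B"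
    using compact_imp_bounded[OF compact_continuous_image[OF assms compact_space]]
    by (auto simp: bounded_iff)
  then show ?thesis
    by (intro integrable_const_bound[of _ B] continuous_measurable assms) auto
qed

lemma continuous_square_integrable:
  fixes f :: "'x \<Rightarrow> 'k"
  assumes "continuous_on UNIV f"
  shows "square_integrable \<mu> f"
  unfolding square_integrable_def
  using assms by (intro conjI continuous_measurable continuous_integrable continuous_intros)

lemma continuous_on_rcnj:
  "continuous_on S f \<Longrightarrow> continuous_on S (\<lambda>x. rcnj (f x :: 'k))"
  by (rule bounded_linear.continuous_on[OF bounded_linear_rcnj])

text \<open>The total mass is 1, so the whole space is not a null set.\<close>

lemma AE_ex: "AE x in \<mu>. P x \<Longrightarrow> \<exists>x. P x"
  using ae_filter_eq_bot_iff[of \<mu>] emeasure_UNIV eventually_happens'[of "ae_filter \<mu>" P] by auto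

section \<open>Harmonic functions: equivariance, continuity and the associated vectors\<close>

lemma H_equivariant:
  assumes "i < mh j" "m < d j"
  shows "H j i m (act g x) = (\<Sum>m'<d j. ip j (Y j m') (\<rho> j (- g) (Y j m)) * H j i m' x)"
proof -
  have "\<forall>j. \<forall>i<mh j. \<forall>m<d j. \<forall>g x.
      H j i m (act (- g) x) = (\<Sum>m'<d j. ip j (Y j m') (\<rho> j g (Y j m)) * H j i m' x)"
    using harmonic unfolding harmonic_basis_def by (elim conjE)
  from this[rule_format, OF assms, of "- g" x] show ?thesis by simp
qed

lemma H_basis: "L2_orthonormal_basis \<mu> {(j, i, m). i < mh j \<and> m < d j} (\<lambda>(j, i, m). H j i m)"
  using harmonic unfolding harmonic_basis_def by (elim conjE)

lemma H_orthonormal: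
  assumes "i < mh j" "m < d j" "i' < mh j'" "m' < d j'"
  shows "(LINT x|\<mu>. rcnj (H j' i' m' x) * H j i m x) = (if (j', i', m') = (j, i, m) then 1 else 0)"
proof -
  let ?I = "{(j, i, m). i < mh j \<and> m < d j}" and ?b = "\<lambda>(j, i, m). H j i m"
  have "\<forall>q\<in>?I. \<forall>q'\<in>?I. (LINT x|\<mu>. rcnj (?b q x) * ?b q' x) = (if q = q' then 1 else 0)"
    using H_basis unfolding L2_orthonormal_basis_def by (elim conjE)
  from bspec[OF bspec[OF this, of "(j', i', m')"], of "(j, i, m)"] show ?thesis
    using assms by simp
qed

lemma matrix_element_continuous_inverse:
  "v \<in> V j \<Longrightarrow> m < d j \<Longrightarrow> continuous_on UNIV (\<lambda>g. ip j (Y j m) (\<rho> j (- g) v))"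
  by (rule continuous_on_compose2[OF rep.continuous_matrix_element]) (auto intro: continuous_intros)

text \<open>Square integrability alone would not give this. The transformation law holds at every
  point, so along an orbit the harmonic is a finite combination of matrix elements of
  \<open>\<rho> j\<close>.\<close>

lemma H_continuous:
  assumes "i < mh j" "m < d j"
  shows "continuous_on UNIV (H j i m)"
proof (rule continuous_on_orbit)
  show "continuous_on UNIV (\<lambda>g. H j i m (act g undefined))"
    unfolding H_equivariant[OF assms]
    using assms by (intro continuous_intros matrix_element_continuous_inverse) auto
qed

text \<open>The vector w_ji(x) of the overview. Since \<open>ip j\<close> is antilinear in its first
  argument, the functional \<open>ip j (hvec j i x)\<close> has the unconjugated harmonics as its
  values on the basis.\<close>

definition hvec :: "'j \<Rightarrow> nat \<Rightarrow> 'x \<Rightarrow> 'v" where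
  "hvec j i x = (\<Sum>m<d j. smul (rcnj (H j i m x)) (Y j m))"

lemma hvec_in [simp]: "hvec j i x \<in> V j"
  unfolding hvec_def by (rule rep.sum_in) simp

lemma ip_hvec: "v \<in> V j \<Longrightarrow> ip j (hvec j i x) v = (\<Sum>m<d j. H j i m x * ip j (Y j m) v)"
  unfolding hvec_def by (rule rep.ip_conj_left)

lemma hvec_equivariant:
  assumes "i < mh j"
  shows "hvec j i (act g x) = \<rho> j g (hvec j i x)"
proof (rule rep.eqI)
  fix m assume m: "m < d j"
  \<comment> \<open>Unitarity: the matrix of \<open>\<rho> j g\<close> is the conjugate transpose of
    the matrix of \<open>\<rho> j (- g)\<close>.\<close>
  have me: "ip j (Y j m) (\<rho> j g (Y j m')) = rcnj (ip j (Y j m') (\<rho> j (- g) (Y j m)))" if "m' < d j" for m'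
  proof -
    have "ip j (Y j m) (\<rho> j g (Y j m')) = ip j (\<rho> j g (\<rho> j (- g) (Y j m))) (\<rho> j g (Y j m'))"
      using m by simp
    also have "\<dots> = ip j (\<rho> j (- g) (Y j m)) (Y j m')"
      using m that by (intro rep.ip_action) auto
    also have "\<dots> = rcnj (ip j (Y j m') (\<rho> j (- g) (Y j m)))"
      using m that by (intro rep.ip_commute) auto
    finally show ?thesis .
  qed
  have "ip j (Y j m) (hvec j i (act g x)) = rcnj (H j i m (act g x))"
    unfolding hvec_def by (rule rep.ip_sum_scale_Y[OF m])
  also have "\<dots> = (\<Sum>m'<d j. rcnj (H j i m' x) * ip j (Y j m) (\<rho> j g (Y j m')))"
    unfolding H_equivariant[OF assms m] rcnj_sum rcnj_mult
    by (intro sum.cong) (simp_all add: me)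
  also have "\<dots> = ip j (Y j m) (\<rho> j g (hvec j i x))"
    unfolding hvec_def using m
    by (subst rep.action_sum_scale, simp, subst rep.ip_sum_scale) auto
  finally show "ip j (Y j m) (hvec j i (act g x)) = ip j (Y j m) (\<rho> j g (hvec j i x))" .
qed auto

section \<open>Steerable kernels and their matrix elements\<close>

context
  fixes l J :: 'j
begin

abbreviation Ker :: "('x \<Rightarrow> 'v \<Rightarrow> 'v) set" where
  "Ker \<equiv> steerable_kernels smul act (R l) (R J)"

abbreviation Dom :: "('j \<times> nat \<times> nat \<Rightarrow> 'v \<Rightarrow> 'v) set" where
  "Dom \<equiv> direct_sum {(j, i, s). i < mh j \<and> s < cgm J j l} (\<lambda>_. End_G smul (R J))"

abbreviation js :: "'j set" where
  "js \<equiv> {j. cgm J j l \<noteq> 0}"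

lemma kernel_linear: "K \<in> Ker \<Longrightarrow> linear_on smul smul (V l) (V J) (K x)"
  and kernel_outside: "K \<in> Ker \<Longrightarrow> w \<notin> V l \<Longrightarrow> K x w = 0"
  and kernel_act: "K \<in> Ker \<Longrightarrow> w \<in> V l \<Longrightarrow> K (act g x) w = \<rho> J g (K x (\<rho> l (- g) w))"
  by (simp_all add: steerable_kernels_def Hom_space_def)

lemmas kernel_in = linear_onD(1)[OF kernel_linear]

lemma kernel_equivariant: "K \<in> Ker \<Longrightarrow> w \<in> V l \<Longrightarrow> K (act g x) (\<rho> l g w) = \<rho> J g (K x w)"
  by (simp add: kernel_act)

lemma kernel_element_continuous:
  assumes K: "K \<in> Ker" and M: "M < d J" and w: "w \<in> V l"
  shows "continuous_on UNIV (\<lambda>x. ip J (Y J M) (K x w))"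
proof (rule continuous_on_orbit)
  let ?x = "undefined :: 'x"
  \<comment> \<open>With the base point fixed, \<open>g\<close> enters only through matrix elements
    of \<open>\<rho> l (- g)\<close> and \<open>\<rho> J g\<close>.\<close>
  have "ip J (Y J M) (K (act g ?x) w)
      = (\<Sum>n<d l. ip l (Y l n) (\<rho> l (- g) w) * ip J (Y J M) (\<rho> J g (K ?x (Y l n))))" for g
  proof -
    have "K ?x (\<rho> l (- g) w) = (\<Sum>n<d l. smul (ip l (Y l n) (\<rho> l (- g) w)) (K ?x (Y l n)))"
      by (rule rep.linear_expand[OF kernel_linear[OF K] rep.action_in[OF w]])
    then have "K (act g ?x) w
        = (\<Sum>n<d l. smul (ip l (Y l n) (\<rho> l (- g) w)) (\<rho> J g (K ?x (Y l n))))"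
      unfolding kernel_act[OF K w] by (simp only:) (auto intro!: rep.action_sum_scale kernel_in[OF K])
    then show ?thesis
      using M by (simp only:) (auto intro!: rep.ip_sum_scale rep.action_in kernel_in[OF K])
  qed
  then show "continuous_on UNIV (\<lambda>g. ip J (Y J M) (K (act g ?x) w))"
    using M w
    by (auto intro!: continuous_intros matrix_element_continuous_inverse rep.continuous_matrix_element
        kernel_in[OF K])
qed

lemma kernel_eq_0:
  assumes K: "K \<in> Ker" and x: "\<And>n. n < d l \<Longrightarrow> K x (Y l n) = 0"
  shows "K = 0"
proof -
  have Kx: "K x w = 0" if "w \<in> V l" for w
    using rep.linear_expand[OF kernel_linear[OF K, of x] that] x by simp
  have "K y w = 0" for y w
  proof (cases "w \<in> V l")
    case True
    obtain g where "y = act g x" using act_transitive by metis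
    then show ?thesis using True by (simp add: kernel_act[OF K] Kx)
  qed (simp add: kernel_outside[OF K])
  then show ?thesis by (simp add: fun_eq_iff)
qed

section \<open>The map from families of endomorphisms to kernels\<close>

definition block :: "('j \<times> nat \<times> nat \<Rightarrow> 'v \<Rightarrow> 'v) \<Rightarrow> 'j \<Rightarrow> nat \<Rightarrow> 'v \<Rightarrow> 'v \<Rightarrow> 'v" where
  "block c j i v w = (\<Sum>s<cgm J j l. c (j, i, s) (cg_component J j l s v w))"

text \<open>Off \<open>js\<close> every block is an empty sum, so this finite sum in effect ranges
  over all \<open>j\<close>. The value 0 off \<open>V l\<close> is the normal form demanded by
  \<open>Hom_space\<close>.\<close>

definition GKer :: "('j \<times> nat \<times> nat \<Rightarrow> 'v \<Rightarrow> 'v) \<Rightarrow> 'x \<Rightarrow> 'v \<Rightarrow> 'v" where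
  "GKer c x w = (if w \<in> V l then \<Sum>j\<in>js. \<Sum>i<mh j. block c j i (hvec j i x) w else 0)"

text \<open>By \<open>finite_multiplicities\<close> the index set is finite, so the finite-support
  condition of the direct sum is automatic and membership can be tested index by index.\<close>

lemma Dom_iff:
  "c \<in> Dom \<longleftrightarrow> (\<forall>j i s. if i < mh j \<and> s < cgm J j l then c (j, i, s) \<in> End_G smul (R J)
     else c (j, i, s) = 0)"
proof -
  let ?I = "{(j, i, s). i < mh j \<and> s < cgm J j l}"
  have "?I \<subseteq> Sigma js (\<lambda>j. {..<mh j} \<times> {..<cgm J j l})" by auto
  then have I: "finite ?I"
    by (rule finite_subset) (intro finite_SigmaI finite_multiplicities; simp)
  have "finite {k. c k \<noteq> 0}" if "\<forall>k. k \<notin> ?I \<longrightarrow> c k = 0"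
    by (rule finite_subset[OF _ I]) (use that in blast)
  then have "c \<in> Dom \<longleftrightarrow> (\<forall>k\<in>?I. c k \<in> End_G smul (R J)) \<and> (\<forall>k. k \<notin> ?I \<longrightarrow> c k = 0)"
    unfolding direct_sum_def by blast
  also have "\<dots> \<longleftrightarrow> (\<forall>j i s. if i < mh j \<and> s < cgm J j l then c (j, i, s) \<in> End_G smul (R J)
     else c (j, i, s) = 0)"
    by auto
  finally show ?thesis .
qed

lemma Dom_End: "c \<in> Dom \<Longrightarrow> i < mh j \<Longrightarrow> s < cgm J j l \<Longrightarrow> c (j, i, s) \<in> End_G smul (R J)"
  unfolding Dom_iff by metis

lemma block_equivariant_bilinear:
  assumes c: "c \<in> Dom" and i: "i < mh j"
  shows "equivariant_bilinear j l J (block c j i)"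
proof -
  note E = Dom_End[OF c i]
  note C = cg_component_equivariant_bilinear
  show ?thesis
    unfolding equivariant_bilinear_def linear_on_def
  proof (intro conjI ballI allI)
    fix v w assume v: "v \<in> V j" and w: "w \<in> V l"
    have cin: "cg_component J j l s v w \<in> V J" if "s < cgm J j l" "v \<in> V j" "w \<in> V l" for s v w
      using equivariant_bilinear_in[OF C] that by blast
    note [simp] = cin End_G_in[OF E] linear_onD(2,3)[OF equivariant_bilinearD(1)[OF C]]
      linear_onD(2,3)[OF equivariant_bilinearD(2)[OF C]] End_G_add[OF E] End_G_scale[OF E]
    show "block c j i v w \<in> V J" "block c j i v w \<in> V J"
      unfolding block_def using v w by (auto intro!: rep.sum_in)
    show "block c j i v (w + w') = block c j i v w + block c j i v w'" if "w' \<in> V l" for w'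
      unfolding block_def sum.distrib[symmetric] using v w that by (intro sum.cong) auto
    show "block c j i v (smul a w) = smul a (block c j i v w)" for a
      unfolding block_def scale_sum_right using v w by (intro sum.cong) auto
    show "block c j i (v + v') w = block c j i v w + block c j i v' w" if "v' \<in> V j" for v'
      unfolding block_def sum.distrib[symmetric] using v w that by (intro sum.cong) auto
    show "block c j i (smul a v) w = smul a (block c j i v w)" for a
      unfolding block_def scale_sum_right using v w by (intro sum.cong) auto
    show "block c j i (\<rho> j g v) (\<rho> l g w) = \<rho> J g (block c j i v w)" for g
      unfolding block_def using v w
      by (subst rep.action_sum)
         (auto intro!: sum.cong simp: equivariant_bilinearD(3)[OF C] End_G_equivariant[OF E])
  qed
qed

lemma GKer_in_Ker:
  assumes c: "c \<in> Dom"
  shows "GKer c \<in> Ker"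
proof -
  note B = block_equivariant_bilinear[OF c]
  have bin: "block c j i (hvec j i x) w \<in> V J" if "i < mh j" "w \<in> V l" for j i x w
    using equivariant_bilinear_in[OF B] that by simp
  have "linear_on smul smul (V l) (V J) (GKer c x)" for x
    unfolding linear_on_def GKer_def
    using bin
    by (auto intro!: rep.sum_in sum.cong
        simp: scale_sum_right sum.distrib[symmetric] linear_onD(2,3)[OF equivariant_bilinearD(1)[OF B]])
  moreover have "GKer c (act g x) w = \<rho> J g (GKer c x (\<rho> l (- g) w))" if w: "w \<in> V l" for g x w
  proof -
    have *: "\<rho> J g (block c j i (hvec j i x) (\<rho> l (- g) w)) = block c j i (hvec j i (act g x)) w"
      if i: "i < mh j" for j i
    proof -
      have "block c j i (hvec j i (act g x)) w
          = block c j i (\<rho> j g (hvec j i x)) (\<rho> l g (\<rho> l (- g) w))"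
        using w i by (simp add: hvec_equivariant)
      also have "\<dots> = \<rho> J g (block c j i (hvec j i x) (\<rho> l (- g) w))"
        using w by (intro equivariant_bilinearD(3)[OF B[OF i]]) auto
      finally show ?thesis by simp
    qed
    have "\<rho> J g (GKer c x (\<rho> l (- g) w))
        = \<rho> J g (\<Sum>j\<in>js. \<Sum>i<mh j. block c j i (hvec j i x) (\<rho> l (- g) w))"
      using w by (simp add: GKer_def)
    also have "\<dots> = (\<Sum>j\<in>js. \<rho> J g (\<Sum>i<mh j. block c j i (hvec j i x) (\<rho> l (- g) w)))"
      by (intro rep.action_sum rep.sum_in bin) (use w in auto)
    also have "\<dots> = (\<Sum>j\<in>js. \<Sum>i<mh j. \<rho> J g (block c j i (hvec j i x) (\<rho> l (- g) w)))"
      using w bin by (intro sum.cong refl rep.action_sum) auto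
    also have "\<dots> = GKer c (act g x) w"
      using w by (simp add: GKer_def *)
    finally show ?thesis by simp
  qed
  moreover have "w \<notin> V l \<Longrightarrow> GKer c x w = 0" for x w
    by (simp add: GKer_def)
  ultimately show ?thesis
    by (simp add: steerable_kernels_def Hom_space_def)
qed

lemma GKer_add: "GKer (c + c') = GKer c + GKer c'"
  by (simp add: GKer_def block_def fun_eq_iff sum.distrib)

lemma GKer_scale: "GKer (fscale (fscale smul) a c) = fscale (fscale smul) a (GKer c)"
  by (simp add: GKer_def block_def fun_eq_iff scale_sum_right)

lemma block_hvec:
  assumes c: "c \<in> Dom" and i: "i < mh j" and w: "w \<in> V l"
  shows "block c j i (hvec j i x) w = (\<Sum>m<d j. smul (rcnj (H j i m x)) (block c j i (Y j m) w))"
proof -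
  note lin = equivariant_bilinearD(2)[OF block_equivariant_bilinear[OF c i] w]
  show ?thesis
    unfolding hvec_def
    by (subst linear_on_sum[OF vector_space_axioms rep.subspace_V lin])
       (auto simp: linear_onD(3)[OF lin])
qed

text \<open>A finite Fourier expansion in conjugated harmonics, so that integrating against the
  plain harmonics extracts its coefficients.\<close>

lemma GKer_element:
  assumes c: "c \<in> Dom" and w: "w \<in> V l" and M: "M < d J"
  shows "ip J (Y J M) (GKer c x w)
    = (\<Sum>j\<in>js. \<Sum>i<mh j. \<Sum>m<d j. rcnj (H j i m x) * ip J (Y J M) (block c j i (Y j m) w))"
proof -
  note B = block_equivariant_bilinear[OF c]
  have bin: "block c j i v w \<in> V J" if "i < mh j" "v \<in> V j" for j i v
    using equivariant_bilinear_in[OF B] that w by simp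
  have "ip J (Y J M) (GKer c x w) = ip J (Y J M) (\<Sum>j\<in>js. \<Sum>i<mh j. block c j i (hvec j i x) w)"
    using w by (simp add: GKer_def)
  also have "\<dots> = (\<Sum>j\<in>js. ip J (Y J M) (\<Sum>i<mh j. block c j i (hvec j i x) w))"
    by (intro rep.ip_sum rep.sum_in bin) (use M in auto)
  also have "\<dots> = (\<Sum>j\<in>js. \<Sum>i<mh j. ip J (Y J M) (block c j i (hvec j i x) w))"
    using M bin by (intro sum.cong refl rep.ip_sum) auto
  also have "\<dots> = (\<Sum>j\<in>js. \<Sum>i<mh j. \<Sum>m<d j. rcnj (H j i m x) * ip J (Y J M) (block c j i (Y j m) w))"
  proof (intro sum.cong refl)
    fix j i assume "i \<in> {..<mh j}"
    then have i: "i < mh j" by simp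
    show "ip J (Y J M) (block c j i (hvec j i x) w)
        = (\<Sum>m<d j. rcnj (H j i m x) * ip J (Y J M) (block c j i (Y j m) w))"
      unfolding block_hvec[OF c i w] using M bin[OF i] by (intro rep.ip_sum_scale) auto
  qed
  finally show ?thesis .
qed

lemma GKer_coefficient:
  assumes c: "c \<in> Dom" and i: "i < mh j" and m: "m < d j" and w: "w \<in> V l" and M: "M < d J"
  shows "(LINT x|\<mu>. H j i m x * ip J (Y J M) (GKer c x w)) = ip J (Y J M) (block c j i (Y j m) w)"
proof -
  let ?f = "\<lambda>j i m. ip J (Y J M) (block c j i (Y j m) w)"
  have int: "integrable \<mu> (\<lambda>x. ?f j' i' m' * (rcnj (H j' i' m' x) * H j i m x))"
    if "i' < mh j'" "m' < d j'" for j' i' m'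
    using i m that by (intro continuous_integrable continuous_intros continuous_on_rcnj H_continuous)
  have "(LINT x|\<mu>. H j i m x * ip J (Y J M) (GKer c x w))
      = (LINT x|\<mu>. (\<Sum>j'\<in>js. \<Sum>i'<mh j'. \<Sum>m'<d j'. ?f j' i' m' * (rcnj (H j' i' m' x) * H j i m x)))"
    unfolding GKer_element[OF c w M] by (simp add: sum_distrib_left mult_ac)
  also have "\<dots> = (\<Sum>j'\<in>js. \<Sum>i'<mh j'. \<Sum>m'<d j'.
      ?f j' i' m' * (LINT x|\<mu>. rcnj (H j' i' m' x) * H j i m x))"
  proof -
    have "(LINT x|\<mu>. (\<Sum>j'\<in>js. \<Sum>i'<mh j'. \<Sum>m'<d j'. ?f j' i' m' * (rcnj (H j' i' m' x) * H j i m x)))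
        = (\<Sum>j'\<in>js. LINT x|\<mu>. (\<Sum>i'<mh j'. \<Sum>m'<d j'. ?f j' i' m' * (rcnj (H j' i' m' x) * H j i m x)))"
      by (intro Bochner_Integration.integral_sum Bochner_Integration.integrable_sum int) auto
    also have "\<dots> = (\<Sum>j'\<in>js. \<Sum>i'<mh j'. LINT x|\<mu>. (\<Sum>m'<d j'. ?f j' i' m' * (rcnj (H j' i' m' x) * H j i m x)))"
      by (intro sum.cong refl Bochner_Integration.integral_sum Bochner_Integration.integrable_sum int) auto
    also have "\<dots> = (\<Sum>j'\<in>js. \<Sum>i'<mh j'. \<Sum>m'<d j'. LINT x|\<mu>. ?f j' i' m' * (rcnj (H j' i' m' x) * H j i m x))"
      by (intro sum.cong refl Bochner_Integration.integral_sum int) auto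
    finally show ?thesis by simp
  qed
  also have "\<dots> = (\<Sum>j'\<in>js. \<Sum>i'<mh j'. \<Sum>m'<d j'. if (j', i', m') = (j, i, m) then ?f j' i' m' else 0)"
    using H_orthonormal[OF i m] by (intro sum.cong refl) auto
  also have "\<dots> = (if j \<in> js \<and> i < mh j \<and> m < d j then ?f j i m else 0)"
    by (rule sum_triple_delta[OF finite_multiplicities])
  \<comment> \<open>If \<open>j \<notin> js\<close>, the block is an empty sum, and the right-hand
    side is 0 as well.\<close>
  also have "\<dots> = ?f j i m"
    using i m M by (auto simp: block_def rep.ip_zero)
  finally show ?thesis .
qed

lemma GKer_inj: "inj_on GKer Dom"
proof (rule inj_onI)
  fix c c' assume c: "c \<in> Dom" and c': "c' \<in> Dom" and eq: "GKer c = GKer c'"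
  have "c (j, i, s) = c' (j, i, s)" if i: "i < mh j" and s: "s < cgm J j l" for j i s
  proof -
    note B = block_equivariant_bilinear[OF c i] and B' = block_equivariant_bilinear[OF c' i]
    have YY: "block c j i (Y j m) w = block c' j i (Y j m) w" if m: "m < d j" and w: "w \<in> V l" for m w
    proof (rule rep.eqI)
      show "ip J (Y J M) (block c j i (Y j m) w) = ip J (Y J M) (block c' j i (Y j m) w)"
        if "M < d J" for M
        unfolding GKer_coefficient[OF c i m w that, symmetric]
          GKer_coefficient[OF c' i m w that, symmetric] eq ..
    qed (use equivariant_bilinear_in[OF B] equivariant_bilinear_in[OF B'] m w in auto)
    have bl: "block c j i v w = block c' j i v w" if v: "v \<in> V j" and w: "w \<in> V l" for v w
    proof -
      note lin = equivariant_bilinearD(2)[OF B w] and lin' = equivariant_bilinearD(2)[OF B' w]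
      show ?thesis
        unfolding rep.linear_expand[OF lin v] rep.linear_expand[OF lin' v]
        by (intro sum.cong) (simp_all add: YY w)
    qed
    \<comment> \<open>Equal blocks mean that the differences of the endomorphisms expand the zero
      map, where uniqueness of the expansion applies.\<close>
    have "c (j, i, s) - c' (j, i, s) = 0"
    proof (rule cg_expansion_unique[where c = "\<lambda>s. c (j, i, s) - c' (j, i, s)"])
      fix s assume "s < cgm J j l"
      then show "c (j, i, s) - c' (j, i, s) \<in> End_G smul (R J)"
        using Dom_End[OF c i] Dom_End[OF c' i]
        by (auto simp: End_G_def Hom_space_def linear_on_def scale_right_diff_distrib rep.action_diff)
    next
      fix v w assume "v \<in> V j" "w \<in> V l"
      from bl[OF this] show "(\<Sum>s<cgm J j l. (c (j, i, s) - c' (j, i, s)) (cg_component J j l s v w)) = 0"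
        by (simp add: block_def sum_subtractf)
    qed (rule s)
    then show ?thesis by simp
  qed
  moreover have "c (j, i, s) = c' (j, i, s)" if "\<not> (i < mh j \<and> s < cgm J j l)" for j i s
    using c c' that unfolding Dom_iff by metis
  ultimately have "c (j, i, s) = c' (j, i, s)" for j i s by blast
  then show "c = c'" by (intro ext) (metis prod_cases3)
qed

text \<open>The integral over \<open>x\<close> of \<open>K x w\<close> weighted by
  \<open>ip j (hvec j i x) v\<close>, taken coordinate by coordinate because the ambient type of
  \<open>V J\<close> carries no topology. Writing the weight with \<open>hvec\<close> makes it
  defined for every \<open>v\<close> and lets a change of variables show equivariance.\<close>

definition coefficient :: "('x \<Rightarrow> 'v \<Rightarrow> 'v) \<Rightarrow> 'j \<Rightarrow> nat \<Rightarrow> 'v \<Rightarrow> 'v \<Rightarrow> 'v" where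
  "coefficient K j i v w =
     (\<Sum>M<d J. smul (LINT x|\<mu>. ip j (hvec j i x) v * ip J (Y J M) (K x w)) (Y J M))"

context
  fixes K j i
  assumes K: "K \<in> Ker" and i: "i < mh j"
begin

lemma coefficient_in: "coefficient K j i v w \<in> V J"
  unfolding coefficient_def by (rule rep.sum_in) simp

lemma ip_coefficient:
  "M < d J \<Longrightarrow>
    ip J (Y J M) (coefficient K j i v w) = (LINT x|\<mu>. ip j (hvec j i x) v * ip J (Y J M) (K x w))"
  unfolding coefficient_def by (rule rep.ip_sum_scale_Y)

lemma coefficient_integrand_continuous:
  assumes "v \<in> V j" "w \<in> V l" "M < d J"
  shows "continuous_on UNIV (\<lambda>x. ip j (hvec j i x) v * ip J (Y J M) (K x w))"
  unfolding ip_hvec[OF assms(1)] using assms i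
  by (intro continuous_intros kernel_element_continuous[OF K] H_continuous) auto

text \<open>Replacing \<open>x\<close> by \<open>act g x\<close> preserves the integral; unitarity
  then removes \<open>g\<close> from the weight, and the steering law moves it to the
  output.\<close>

lemma coefficient_equivariant_bilinear: "equivariant_bilinear j l J (coefficient K j i)"
  unfolding equivariant_bilinear_def linear_on_def
proof (intro conjI ballI allI)
  fix v w assume v: "v \<in> V j" and w: "w \<in> V l"
  note int = continuous_integrable[OF coefficient_integrand_continuous]
  show "coefficient K j i v w \<in> V J" "coefficient K j i v w \<in> V J"
    by (rule coefficient_in)+
  show "coefficient K j i v (w + w') = coefficient K j i v w + coefficient K j i v w'"
    if "w' \<in> V l" for w'
    using v w that int coefficient_in
    by (intro rep.eqI[where j = J]) (auto simp: rep.ip_add ip_coefficient linear_onD(2)[OF kernel_linear[OF K]]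
        kernel_in[OF K] distrib_left)
  show "coefficient K j i v (smul a w) = smul a (coefficient K j i v w)" for a
    using v w int coefficient_in
    by (intro rep.eqI[where j = J]) (auto simp: rep.ip_scale ip_coefficient linear_onD(3)[OF kernel_linear[OF K]]
        kernel_in[OF K] mult.left_commute)
  show "coefficient K j i (v + v') w = coefficient K j i v w + coefficient K j i v' w"
    if "v' \<in> V j" for v'
    using v w that int coefficient_in
    by (intro rep.eqI[where j = J]) (auto simp: rep.ip_add ip_coefficient distrib_right)
  show "coefficient K j i (smul a v) w = smul a (coefficient K j i v w)" for a
    using v w int coefficient_in
    by (intro rep.eqI[where j = J]) (auto simp: rep.ip_scale ip_coefficient mult.assoc)
  fix g
  show "coefficient K j i (\<rho> j g v) (\<rho> l g w) = \<rho> J g (coefficient K j i v w)"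
  proof (rule rep.eqI)
    fix M assume M: "M < d J"
    let ?r = "\<lambda>M'. ip J (Y J M) (\<rho> J g (Y J M'))"
    \<comment> \<open>The action on the output is written through its matrix, whose entries can be
      taken out of the integral.\<close>
    have act: "ip J (Y J M) (\<rho> J g u) = (\<Sum>M'<d J. ?r M' * ip J (Y J M') u)" if u: "u \<in> V J" for u
    proof -
      have "ip J (Y J M) (\<rho> J g u) = ip J (Y J M) (\<Sum>M'<d J. smul (ip J (Y J M') u) (\<rho> J g (Y J M')))"
        by (simp only: rep.linear_expand[OF rep.action_linear u, symmetric])
      also have "\<dots> = (\<Sum>M'<d J. ?r M' * ip J (Y J M') u)"
        using M by (subst rep.ip_sum_scale) (auto simp: mult.commute)
      finally show ?thesis .
    qed
    have "ip J (Y J M) (coefficient K j i (\<rho> j g v) (\<rho> l g w))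
        = (LINT x|\<mu>. ip j (hvec j i x) (\<rho> j g v) * ip J (Y J M) (K x (\<rho> l g w)))"
      by (rule ip_coefficient[OF M])
    also have "\<dots> = (LINT x|\<mu>. ip j (hvec j i (act g x)) (\<rho> j g v)
        * ip J (Y J M) (K (act g x) (\<rho> l g w)))"
      using v w M
      by (intro integral_act[symmetric, of "\<lambda>x. ip j (hvec j i x) (\<rho> j g v) * ip J (Y J M) (K x (\<rho> l g w))"]
            coefficient_integrand_continuous) auto
    also have "\<dots> = (LINT x|\<mu>. ip j (hvec j i x) v * ip J (Y J M) (\<rho> J g (K x w)))"
      using v w i by (simp add: hvec_equivariant rep.ip_action kernel_equivariant[OF K])
    also have "\<dots> = (LINT x|\<mu>. (\<Sum>M'<d J. ?r M' * (ip j (hvec j i x) v * ip J (Y J M') (K x w))))"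
      using w by (simp add: act kernel_in[OF K] sum_distrib_left mult_ac)
    also have "\<dots> = (\<Sum>M'<d J. ?r M' * (LINT x|\<mu>. ip j (hvec j i x) v * ip J (Y J M') (K x w)))"
      using int[OF v w] by simp
    also have "\<dots> = ip J (Y J M) (\<rho> J g (coefficient K j i v w))"
      by (simp add: act[OF coefficient_in] ip_coefficient)
    finally show "ip J (Y J M) (coefficient K j i (\<rho> j g v) (\<rho> l g w))
        = ip J (Y J M) (\<rho> J g (coefficient K j i v w))" .
  qed (simp_all add: coefficient_in)
qed

lemma ip_coefficient_Y:
  assumes "m < d j" "M < d J"
  shows "ip J (Y J M) (coefficient K j i (Y j m) w) = (LINT x|\<mu>. H j i m x * ip J (Y J M) (K x w))"
proof -
  have "ip j (hvec j i x) (Y j m) = H j i m x" for x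
  proof -
    have "ip j (hvec j i x) (Y j m) = (\<Sum>m'<d j. if m = m' then H j i m' x else 0)"
      unfolding ip_hvec[OF rep.Y_in[OF assms(1)]]
      using assms by (intro sum.cong) (auto simp: rep.ip_Y)
    then show ?thesis using assms by simp
  qed
  then show ?thesis by (simp add: ip_coefficient[OF assms(2)])
qed

end

lemma kernel_diff:
  assumes "K \<in> Ker" "K' \<in> Ker"
  shows "K - K' \<in> Ker"
  using assms
  by (auto simp: steerable_kernels_def Hom_space_def linear_on_def scale_right_diff_distrib rep.action_diff)

lemma kernel_orthogonal_eq_0:
  assumes K: "K \<in> Ker"
    and orth: "\<And>j i m M n. i < mh j \<Longrightarrow> m < d j \<Longrightarrow> M < d J \<Longrightarrow> n < d l \<Longrightarrow>
      (LINT x|\<mu>. H j i m x * ip J (Y J M) (K x (Y l n))) = 0"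
  shows "K = 0"
proof -
  have "AE x in \<mu>. ip J (Y J M) (K x (Y l n)) = 0" if M: "M < d J" and n: "n < d l" for M n
  proof -
    \<comment> \<open>\<open>L2_orthonormal_basis_complete\<close> conjugates its function, hence
      the conjugated matrix element: the two conjugations cancel and leave the integral in
      \<open>orth\<close>.\<close>
    have "AE x in \<mu>. rcnj (ip J (Y J M) (K x (Y l n))) = 0"
    proof (rule L2_orthonormal_basis_complete[OF H_basis])
      show "square_integrable \<mu> (\<lambda>x. rcnj (ip J (Y J M) (K x (Y l n))))"
        using M n by (intro continuous_square_integrable continuous_on_rcnj
            kernel_element_continuous[OF K]) auto
    qed (use orth M n in \<open>auto simp: mult.commute\<close>)
    then show ?thesis by simp
  qed
  \<comment> \<open>There are finitely many matrix elements, so the union of their exceptional null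
    sets is null and one point serves for all of them.\<close>
  then have "AE x in \<mu>. \<forall>M\<in>{..<d J}. \<forall>n\<in>{..<d l}. ip J (Y J M) (K x (Y l n)) = 0"
    by (intro AE_finite_allI) auto
  then obtain x where x: "\<forall>M\<in>{..<d J}. \<forall>n\<in>{..<d l}. ip J (Y J M) (K x (Y l n)) = 0"
    using AE_ex by blast
  show ?thesis
  proof (rule kernel_eq_0[OF K])
    show "K x (Y l n) = 0" if n: "n < d l" for n
      by (rule rep.eqI[where j = J]) (use x n in \<open>auto simp: kernel_in[OF K] rep.ip_zero\<close>)
  qed
qed

lemma GKer_surj:
  assumes K: "K \<in> Ker"
  shows "\<exists>c\<in>Dom. GKer c = K"
proof -
  \<comment> \<open>\<open>P j i e\<close> says that the family \<open>e\<close> represents the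
    Fourier coefficient of \<open>K\<close> at \<open>(j, i)\<close>; one such family is chosen for
    each pair.\<close>
  define P where "P j i e \<longleftrightarrow> (\<forall>s<cgm J j l. e s \<in> End_G smul (R J)) \<and> (\<forall>v\<in>V j. \<forall>w\<in>V l.
      coefficient K j i v w = (\<Sum>s<cgm J j l. e s (cg_component J j l s v w)))" for j i e
  have ex: "\<exists>e. P j i e" if i: "i < mh j" for j i
    by (rule cg_expansion[OF coefficient_equivariant_bilinear[OF K i]]) (auto simp: P_def)
  define e where "e j i = (SOME e. P j i e)" for j i
  have "P j i (e j i)" if "i < mh j" for j i
    unfolding e_def by (rule someI_ex[OF ex[OF that]])
  then have e: "\<And>j i s. i < mh j \<Longrightarrow> s < cgm J j l \<Longrightarrow> e j i s \<in> End_G smul (R J)"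
    and e_sum: "\<And>j i v w. i < mh j \<Longrightarrow> v \<in> V j \<Longrightarrow> w \<in> V l \<Longrightarrow>
      coefficient K j i v w = (\<Sum>s<cgm J j l. e j i s (cg_component J j l s v w))"
    unfolding P_def by blast+
  define c where "c = (\<lambda>(j, i, s). if i < mh j \<and> s < cgm J j l then e j i s else 0)"
  have c: "c \<in> Dom" using e by (simp add: Dom_iff c_def)
  \<comment> \<open>For \<open>j\<close> outside \<open>js\<close> the expansion is empty and says
    that the coefficient itself is zero, so the finite sum in \<open>GKer c\<close> misses no part
    of \<open>K\<close>.\<close>
  have block: "block c j i v w = coefficient K j i v w" if "i < mh j" "v \<in> V j" "w \<in> V l" for j i v w
    using that by (simp add: block_def c_def e_sum)
  note G = GKer_in_Ker[OF c]
  have "K - GKer c = 0"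
  proof (rule kernel_orthogonal_eq_0[OF kernel_diff[OF K G]])
    fix j i m M n assume i: "i < mh j" and m: "m < d j" and M: "M < d J" and n: "n < d l"
    have int: "integrable \<mu> (\<lambda>x. H j i m x * ip J (Y J M) (K' x (Y l n)))" if "K' \<in> Ker" for K'
      using i m M n
      by (intro continuous_integrable continuous_intros H_continuous kernel_element_continuous[OF that]) auto
    have "(LINT x|\<mu>. H j i m x * ip J (Y J M) ((K - GKer c) x (Y l n)))
        = (LINT x|\<mu>. H j i m x * ip J (Y J M) (K x (Y l n)) - H j i m x * ip J (Y J M) (GKer c x (Y l n)))"
      using M n by (simp add: rep.ip_diff kernel_in[OF K] kernel_in[OF G] right_diff_distrib)
    also have "\<dots> = 0"
      using int[OF K] int[OF G] i m M n
      by (simp add: GKer_coefficient[OF c] block flip: ip_coefficient_Y[OF K])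
    finally show "(LINT x|\<mu>. H j i m x * ip J (Y J M) ((K - GKer c) x (Y l n))) = 0" .
  qed
  then show ?thesis using c by auto
qed

section \<open>Matrix elements in terms of Clebsch-Gordan coefficients\<close>

lemma cg_coeff_eq:
  assumes "M < d J"
  shows "cg_coeff smul R Y CG s J M j m l n = ip J (Y J M) (cg_component J j l s (Y j m) (Y l n))"
proof -
  \<comment> \<open>\<open>direct_sum_inner\<close> sums over the support of its first argument,
    which is a single index because basis vectors are nonzero.\<close>
  have "{k. ((\<lambda>_. 0)((J, s) := Y J M)) k \<noteq> 0} = {(J, s)}"
    using rep.Y_nonzero[OF assms] by auto
  then show ?thesis
    by (simp add: cg_coeff_def direct_sum_inner_def cg_component_def)
qed

lemma block_element:
  assumes c: "c \<in> Dom" and i: "i < mh j" and m: "m < d j" and n: "n < d l" and M: "M < d J"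
  shows "ip J (Y J M) (block c j i (Y j m) (Y l n))
    = (\<Sum>s<cgm J j l. \<Sum>M'<d J. ip J (Y J M) (c (j, i, s) (Y J M')) * cg_coeff smul R Y CG s J M' j m l n)"
proof -
  let ?u = "\<lambda>s. cg_component J j l s (Y j m) (Y l n)"
  note E = Dom_End[OF c i]
  have u: "?u s \<in> V J" if "s < cgm J j l" for s
    using that m n by (intro equivariant_bilinear_in[OF cg_component_equivariant_bilinear]) auto
  have "ip J (Y J M) (c (j, i, s) (?u s))
      = (\<Sum>M'<d J. ip J (Y J M) (c (j, i, s) (Y J M')) * cg_coeff smul R Y CG s J M' j m l n)"
    if s: "s < cgm J j l" for s
  proof -
    \<comment> \<open>Expanding the component in the basis \<open>Y J M'\<close> before the
      endomorphism acts produces the extra summation index.\<close>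
    have "ip J (Y J M) (c (j, i, s) (?u s))
        = (\<Sum>M'<d J. ip J (Y J M') (?u s) * ip J (Y J M) (c (j, i, s) (Y J M')))"
      unfolding rep.linear_expand[OF End_G_linear[OF E[OF s]] u[OF s]]
      using M End_G_in[OF E[OF s]] by (intro rep.ip_sum_scale) auto
    also have "\<dots> = (\<Sum>M'<d J. ip J (Y J M) (c (j, i, s) (Y J M')) * cg_coeff smul R Y CG s J M' j m l n)"
      by (intro sum.cong) (simp_all add: cg_coeff_eq)
    finally show ?thesis .
  qed
  then show ?thesis
    unfolding block_def using M u End_G_in[OF E] by (subst rep.ip_sum) auto
qed

lemma GKer_formula:
  assumes c: "c \<in> Dom" and M: "M < d J" and n: "n < d l"
  shows "ip J (Y J M) (GKer c x (Y l n)) =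
    (\<Sum>j\<in>js. \<Sum>i<mh j. \<Sum>s<cgm J j l. \<Sum>m<d j. \<Sum>M'<d J.
       ip J (Y J M) (c (j, i, s) (Y J M')) * cg_coeff smul R Y CG s J M' j m l n * rcnj (H j i m x))"
proof -
  have eq: "(\<Sum>m<d j. rcnj (H j i m x) * ip J (Y J M) (block c j i (Y j m) (Y l n)))
      = (\<Sum>s<cgm J j l. \<Sum>m<d j. \<Sum>M'<d J.
       ip J (Y J M) (c (j, i, s) (Y J M')) * cg_coeff smul R Y CG s J M' j m l n * rcnj (H j i m x))"
    if i: "i < mh j" for j i
  proof -
    have "(\<Sum>m<d j. rcnj (H j i m x) * ip J (Y J M) (block c j i (Y j m) (Y l n)))
      = (\<Sum>m<d j. \<Sum>s<cgm J j l. \<Sum>M'<d J.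
       ip J (Y J M) (c (j, i, s) (Y J M')) * cg_coeff smul R Y CG s J M' j m l n * rcnj (H j i m x))"
      using block_element[OF c i _ n M]
      by (intro sum.cong refl) (simp add: sum_distrib_left mult_ac)
    then show ?thesis by (subst sum.swap)
  qed
  show ?thesis
    unfolding GKer_element[OF c rep.Y_in[OF n] M]
    by (rule sum.cong[OF refl], rule sum.cong[OF refl]) (simp add: eq)
qed

lemma GKer_isomorphism:
  "linear_on (fscale (fscale smul)) (fscale (fscale smul)) Dom Ker GKer" "bij_betw GKer Dom Ker"
proof -
  show "linear_on (fscale (fscale smul)) (fscale (fscale smul)) Dom Ker GKer"
    using GKer_in_Ker GKer_add GKer_scale by (simp add: linear_on_def)
  have "GKer ` Dom = Ker"
    using GKer_in_Ker GKer_surj by blast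
  then show "bij_betw GKer Dom Ker"
    using GKer_inj by (simp add: bij_betw_def)
qed

end

end

theorem theorem4p1:
  fixes smul :: "'k::rc_field \<Rightarrow> 'v::ab_group_add \<Rightarrow> 'v"
    and act :: "'g::{topological_group_add, t2_space} \<Rightarrow> 'x::t2_space \<Rightarrow> 'x"
    and \<mu> :: "'x measure"
    and R :: "'j \<Rightarrow> ('g, 'v, 'k) rep"
    and Y :: "'j \<Rightarrow> nat \<Rightarrow> 'v"
    and mh :: "'j \<Rightarrow> nat"
    and H :: "'j \<Rightarrow> nat \<Rightarrow> nat \<Rightarrow> 'x \<Rightarrow> 'k"
    and cgm :: "'j \<Rightarrow> 'j \<Rightarrow> 'j \<Rightarrow> nat"
    and CG :: "'j \<Rightarrow> 'j \<Rightarrow> (('v \<Rightarrow> 'v \<Rightarrow> 'k) \<Rightarrow> 'k) \<Rightarrow> ('j \<times> nat \<Rightarrow> 'v)"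
    and l J :: 'j
  assumes "compact (UNIV :: 'g set)"
    and "homogeneous_space act"
    and "invariant_measure act \<mu>"
    and "vector_space smul"
    and "irrep_representatives smul R"
    and "\<And>j. orthonormal_basis smul (R j) (Y j)"
    and "harmonic_basis smul act \<mu> R Y mh H"
    and "clebsch_gordan smul R cgm CG"
  shows "let Dom = direct_sum {(j, i, s). i < mh j \<and> s < cgm J j l} (\<lambda>_. End_G smul (R J));
             Ker = steerable_kernels smul act (R l) (R J)
         in \<exists>GKer :: ('j \<times> nat \<times> nat \<Rightarrow> 'v \<Rightarrow> 'v) \<Rightarrow> 'x \<Rightarrow> 'v \<Rightarrow> 'v.
           linear_on (fscale (fscale smul)) (fscale (fscale smul)) Dom Ker GKer \<and>
           bij_betw GKer Dom Ker \<and>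
           (\<forall>c\<in>Dom. \<forall>x. \<forall>M<rdim smul (R J). \<forall>n<rdim smul (R l).
              rinner (R J) (Y J M) (GKer c x (Y l n)) =
              (\<Sum>j\<in>{j. cgm J j l \<noteq> 0}. \<Sum>i<mh j. \<Sum>s<cgm J j l.
                 \<Sum>m<rdim smul (R j). \<Sum>M'<rdim smul (R J).
                   rinner (R J) (Y J M) (c (j, i, s) (Y J M'))
                   * cg_coeff smul R Y CG s J M' j m l n
                   * rcnj (H j i m x)))"
proof -
  interpret vector_space smul by fact
  interpret harmonic_setting smul R Y cgm CG act \<mu> mh H
    by unfold_locales (fact assms)+
  show ?thesis
    unfolding Let_def
    by (rule exI[of _ "GKer l J"]) (use GKer_isomorphism GKer_formula in blast)
qed

end
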